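(* For a fixed first-stage decision $\hat{\mathbf{x}}$, the column generation (CG) procedure described in the context converges to the optimum of the worst-case expectation problem $$v(\hat{\mathbf{x}})=\max_{\mathbb{P}\in\mathcal{P}}\ \mathbb{E}_{\mathbb{P}}\big[Q(\hat{\mathbf{x}},\bm{\xi})\big]$$ in a finite number of iterations, and this number is bounded by $3^{m_\xi}\cdot S$.
   Context: **Data.** First-stage decisions are vectors $\mathbf{x}\in\{0,1\}^{n_x}\times\mathbb{R}_+^{m_x}$ with $\mathbf{A}\mathbf{x}\le\mathbf{b}$. $\Xi=\prod_{i=1}^{m_\xi}[\underline{\xi}^i,\overline{\xi}^i]\subseteq\mathbb{R}^{m_\xi}$ is a box (the sample space), $\mathcal{F}$ is a $\sigma$-algebra of $\Xi$, and $\mathcal{M}(\Xi,\mathcal{F})$ is the set of all probability distributions on $(\Xi,\mathcal{F})$. The recourse function is $$Q(\mathbf{x},\bm{\xi})=\min_{\mathbf{y}\in\mathbb{R}_+^{m_y}}\{\mathbf{d}^\intercal\mathbf{y}:\ \mathbf{F}\mathbf{y}\le\mathbf{h}-\mathbf{G}\mathbf{x}-\mathbf{K}\bm{\xi}\},$$ with fixed real matrices and vectors of compatible sizes. The problem has relatively complete recourse: for all first-stage decisions $\mathbf{x}$ and all $\bm{\xi}\in\Xi$ the recourse problem is feasible and $|Q(\mathbf{x},\bm{\xi})|<\infty$. **Ambiguity set.** $\bm{\xi}_1^{\rm e},\dots,\bm{\xi}_S^{\rm e}$ are $S$ given samples of $\bm{\xi}$ with probabilities $\pi_s^{\rm e}$,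 $\sum_{s=1}^S\pi_s^{\rm e}=1$, and $\mathbb{P}^{\rm e}=\sum_{s=1}^S\pi_s^{\rm e}\delta_{\bm{\xi}_s^{\rm e}}$ is the empirical distribution. For a radius $r\ge0$, $\mathcal{P}=\{\mathbb{P}\in\mathcal{M}(\Xi,\mathcal{F}):\mathfrak{d}_{\rm w}(\mathbb{P},\mathbb{P}^{\rm e})\le r\}$, where $\mathfrak{d}_{\rm w}$ is the Wasserstein metric (minimum over couplings of the expected transport cost) with cost $\|\cdot\|_1$. **CG procedure for fixed $\hat{\mathbf{x}}$.** Write $[S]=\{1,\dots,S\}$. For each $s\in[S]$ a set $\Omega_s$ of scenarios is maintained. It contains the scenarios available so far: in general some given scenarios at the start, and in the convergence analysis $\Omega_s=\emptyset$ for all $s$ at the start. Each iteration does the following. 1. Solve the pricing master problem (a linear program) $$\max_{\pi_{\bm{\xi}_s}\ge0}\ \sum_{s=1}^S\sum_{\bm{\xi}_s\in\Omega_s}\pi_s^{\rm e}Q(\hat{\mathbf{x}},\bm{\xi}_s)\pi_{\bm{\xi}_s}$$ subject to $\sum_{\bm{\xi}_s\in\Omega_s}\pi_{\bm{\xi}_s}=1$ for all $s\in[S]$ (multipliers $\alpha_s\in\mathbb{R}$) and $\sum_{s=1}^S\pi_s^{\rm e}\sum_{\bm{\xi}_s\in\Omega_s}\|\bm{\xi}_s-\bm{\xi}_s^{\rm e}\|_1\pi_{\bm{\xi}_s}\le r$ (multiplier $\beta\ge0$), and take optimal multipliers $\hat\alpha_1,\dots,\hat\alpha_S,\hat\beta$.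 2. For each $s\in[S]$ solve the pricing subproblem $$\mu_s=\max_{\bm{\xi}_s\in\Xi}\ \pi_s^{\rm e}\big(Q(\hat{\mathbf{x}},\bm{\xi}_s)-\hat\beta\|\bm{\xi}_s-\bm{\xi}_s^{\rm e}\|_1\big)-\hat\alpha_s .$$ It is solved in an equivalent mixed-integer linear form in which every component of the optimal scenario $\hat{\bm{\xi}}_s$ satisfies $\hat\xi_s^i\in\{\overline{\xi}^i,\underline{\xi}^i,\xi_s^{{\rm e},i}\}$ (an optimal solution of this form exists). 3. If $\mu_s\le0$ for all $s\in[S]$, stop. Otherwise, for $s'$ with $\mu_{s'}>0$, create a new variable $\pi_{\hat{\bm{\xi}}_{s'}}$ in the master problem, replace $\Omega_{s'}$ by $\Omega_{s'}\cup\{\hat{\bm{\xi}}_{s'}\}$, and repeat.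
   Formalization: If the master problem is infeasible (e.g. Ω_s empty), optimal multipliers do not exist; any dual feasible multipliers with dual value below the empirical expectation of Q are then taken. The last pass, which only stops, is not counted. The σ-algebra is assumed to contain the Borel sets of Ξ. *)

theory Defs
  imports "HOL-Probability.Probability"
begin

text \<open>The coordinates in \<open>Bin\<close> are the binary ones, the others are continuous and nonnegative.\<close>

definition first_stage_set ::
  "real^'n^'c \<Rightarrow> real^'c \<Rightarrow> 'n set \<Rightarrow> (real^'n) set" where
  "first_stage_set A b Bin =
     {x. 0 \<le> x \<and> (\<forall>i\<in>Bin. x $ i \<in> {0, 1}) \<and> A *v x \<le> b}"

definition recourse_feasible ::
  "real^'y^'l \<Rightarrow> real^'l \<Rightarrow> real^'n^'l \<Rightarrow> real^'m^'l \<Rightarrow> real^'n \<Rightarrow> real^'m \<Rightarrow> (real^'y) set" where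
  "recourse_feasible F h G K x \<xi> = {y. 0 \<le> y \<and> F *v y \<le> h - G *v x - K *v \<xi>}"

definition recourse ::
  "real^'y \<Rightarrow> real^'y^'l \<Rightarrow> real^'l \<Rightarrow> real^'n^'l \<Rightarrow> real^'m^'l \<Rightarrow> real^'n \<Rightarrow> real^'m \<Rightarrow> real" where
  "recourse d F h G K x \<xi> = (INF y\<in>recourse_feasible F h G K x \<xi>. d \<bullet> y)"

text \<open>The two conjuncts say that the recourse value is neither \<open>\<infinity>\<close> nor \<open>-\<infinity>\<close>;
  the real-valued infimum above is meaningful exactly then.\<close>

definition relatively_complete_recourse ::
  "real^'y \<Rightarrow> real^'y^'l \<Rightarrow> real^'l \<Rightarrow> real^'n^'l \<Rightarrow> real^'m^'l
    \<Rightarrow> (real^'n) set \<Rightarrow> (real^'m) set \<Rightarrow> bool" where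
  "relatively_complete_recourse d F h G K X \<Xi> \<longleftrightarrow>
     (\<forall>x\<in>X. \<forall>\<xi>\<in>\<Xi>. recourse_feasible F h G K x \<xi> \<noteq> {} \<and>
        bdd_below ((\<lambda>y. d \<bullet> y) ` recourse_feasible F h G K x \<xi>))"

definition norm1 :: "real^'m \<Rightarrow> real" where
  "norm1 v = (\<Sum>i\<in>UNIV. \<bar>v $ i\<bar>)"

definition distributions :: "'a set \<Rightarrow> 'a set set \<Rightarrow> 'a measure set" where
  "distributions \<Xi> \<F> = {P. prob_space P \<and> space P = \<Xi> \<and> sets P = \<F>}"

definition couplings :: "'a measure \<Rightarrow> 'b measure \<Rightarrow> ('a \<times> 'b) measure set" where
  "couplings P R =
     {\<gamma>. sets \<gamma> = sets (P \<Otimes>\<^sub>M R) \<and> distr \<gamma> P fst = P \<and> distr \<gamma> R snd = R}"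

definition wasserstein :: "(real^'m) measure \<Rightarrow> (real^'m) measure \<Rightarrow> ennreal" where
  "wasserstein P R =
     (INF \<gamma>\<in>couplings P R. \<integral>\<^sup>+ z. ennreal (norm1 (fst z - snd z)) \<partial>\<gamma>)"

definition empirical ::
  "'a set \<Rightarrow> 'a set set \<Rightarrow> ('s::finite \<Rightarrow> 'a) \<Rightarrow> ('s \<Rightarrow> real) \<Rightarrow> 'a measure" where
  "empirical \<Xi> \<F> \<xi>e \<pi>e =
     measure_of \<Xi> \<F> (\<lambda>E. \<Sum>s\<in>UNIV. ennreal (\<pi>e s) * indicator E (\<xi>e s))"

definition ambiguity_set ::
  "(real^'m) set \<Rightarrow> (real^'m) set set \<Rightarrow> ('s::finite \<Rightarrow> real^'m) \<Rightarrow> ('s \<Rightarrow> real) \<Rightarrow> real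
    \<Rightarrow> (real^'m) measure set" where
  "ambiguity_set \<Xi> \<F> \<xi>e \<pi>e r =
     {P \<in> distributions \<Xi> \<F>. wasserstein P (empirical \<Xi> \<F> \<xi>e \<pi>e) \<le> ennreal r}"

text \<open>Below, \<open>q\<close> is the recourse function at the fixed first-stage decision. A family \<open>\<Omega>\<close>
  holds the scenarios currently available, and \<open>p s \<xi>\<close> is the master variable of scenario
  \<open>\<xi> \<in> \<Omega> s\<close>.\<close>

definition master_feasible ::
  "('s::finite \<Rightarrow> real^'m) \<Rightarrow> ('s \<Rightarrow> real) \<Rightarrow> real \<Rightarrow> ('s \<Rightarrow> (real^'m) set)
    \<Rightarrow> ('s \<Rightarrow> real^'m \<Rightarrow> real) \<Rightarrow> bool" where
  "master_feasible \<xi>e \<pi>e r \<Omega> p \<longleftrightarrow>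
     (\<forall>s. \<forall>\<xi>\<in>\<Omega> s. 0 \<le> p s \<xi>) \<and>
     (\<forall>s. (\<Sum>\<xi>\<in>\<Omega> s. p s \<xi>) = 1) \<and>
     (\<Sum>s\<in>UNIV. \<pi>e s * (\<Sum>\<xi>\<in>\<Omega> s. norm1 (\<xi> - \<xi>e s) * p s \<xi>)) \<le> r"

definition master_objective ::
  "('s::finite \<Rightarrow> real) \<Rightarrow> (real^'m \<Rightarrow> real) \<Rightarrow> ('s \<Rightarrow> (real^'m) set)
    \<Rightarrow> ('s \<Rightarrow> real^'m \<Rightarrow> real) \<Rightarrow> real" where
  "master_objective \<pi>e q \<Omega> p = (\<Sum>s\<in>UNIV. \<Sum>\<xi>\<in>\<Omega> s. \<pi>e s * q \<xi> * p s \<xi>)"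

definition dual_feasible ::
  "('s::finite \<Rightarrow> real^'m) \<Rightarrow> ('s \<Rightarrow> real) \<Rightarrow> (real^'m \<Rightarrow> real) \<Rightarrow> ('s \<Rightarrow> (real^'m) set)
    \<Rightarrow> ('s \<Rightarrow> real) \<times> real \<Rightarrow> bool" where
  "dual_feasible \<xi>e \<pi>e q \<Omega> = (\<lambda>(\<alpha>, \<beta>).
     0 \<le> \<beta> \<and> (\<forall>s. \<forall>\<xi>\<in>\<Omega> s. \<pi>e s * q \<xi> \<le> \<alpha> s + \<pi>e s * norm1 (\<xi> - \<xi>e s) * \<beta>))"

definition dual_objective :: "real \<Rightarrow> ('s::finite \<Rightarrow> real) \<times> real \<Rightarrow> real" where
  "dual_objective r = (\<lambda>(\<alpha>, \<beta>). (\<Sum>s\<in>UNIV. \<alpha> s) + r * \<beta>)"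

text \<open>Optimal multipliers are the optimal solutions of the linear programming dual of the
  master problem. If the master problem is infeasible (for instance if some \<open>\<Omega> s\<close> is empty), its
  dual is unbounded and has no optimal solution. The convention is then to take any dual
  feasible multipliers whose dual value lies below the expected recourse cost under the
  empirical distribution.\<close>

definition master_multipliers ::
  "('s::finite \<Rightarrow> real^'m) \<Rightarrow> ('s \<Rightarrow> real) \<Rightarrow> real \<Rightarrow> (real^'m \<Rightarrow> real) \<Rightarrow> ('s \<Rightarrow> (real^'m) set)
    \<Rightarrow> ('s \<Rightarrow> real) \<times> real \<Rightarrow> bool" where
  "master_multipliers \<xi>e \<pi>e r q \<Omega> m \<longleftrightarrow>
     (if \<exists>p. master_feasible \<xi>e \<pi>e r \<Omega> p
      then is_arg_min (dual_objective r) (dual_feasible \<xi>e \<pi>e q \<Omega>) m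
      else dual_feasible \<xi>e \<pi>e q \<Omega> m \<and> dual_objective r m < (\<Sum>s\<in>UNIV. \<pi>e s * q (\<xi>e s)))"

definition pricing_objective ::
  "('s::finite \<Rightarrow> real^'m) \<Rightarrow> ('s \<Rightarrow> real) \<Rightarrow> (real^'m \<Rightarrow> real) \<Rightarrow> ('s \<Rightarrow> real) \<times> real
    \<Rightarrow> 's \<Rightarrow> real^'m \<Rightarrow> real" where
  "pricing_objective \<xi>e \<pi>e q = (\<lambda>(\<alpha>, \<beta>) s \<xi>.
     \<pi>e s * (q \<xi> - \<beta> * norm1 (\<xi> - \<xi>e s)) - \<alpha> s)"

definition pricing_solution ::
  "real^'m \<Rightarrow> real^'m \<Rightarrow> ('s::finite \<Rightarrow> real^'m) \<Rightarrow> ('s \<Rightarrow> real) \<Rightarrow> (real^'m \<Rightarrow> real)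
    \<Rightarrow> ('s \<Rightarrow> real) \<times> real \<Rightarrow> 's \<Rightarrow> real^'m \<Rightarrow> bool" where
  "pricing_solution lo hi \<xi>e \<pi>e q m s \<xi> \<longleftrightarrow>
     is_arg_max (pricing_objective \<xi>e \<pi>e q m s) (\<lambda>\<zeta>. \<zeta> \<in> cbox lo hi) \<xi> \<and>
     (\<forall>i. \<xi> $ i \<in> {hi $ i, lo $ i, \<xi>e s $ i})"

text \<open>The outcome of one round of solving the master problem and the subproblems consists of
  multipliers \<open>m\<close> and optimal scenarios \<open>\<zeta>\<close>. The value \<open>pricing_objective \<xi>e \<pi>e q m s (\<zeta> s)\<close> is the optimal value
  \<open>\<mu>\<close> of the subproblem of \<open>s\<close>.\<close>

definition cg_pass ::
  "real^'m \<Rightarrow> real^'m \<Rightarrow> ('s::finite \<Rightarrow> real^'m) \<Rightarrow> ('s \<Rightarrow> real) \<Rightarrow> real \<Rightarrow> (real^'m \<Rightarrow> real)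
    \<Rightarrow> ('s \<Rightarrow> (real^'m) set) \<Rightarrow> ('s \<Rightarrow> real) \<times> real \<Rightarrow> ('s \<Rightarrow> real^'m) \<Rightarrow> bool" where
  "cg_pass lo hi \<xi>e \<pi>e r q \<Omega> m \<zeta> \<longleftrightarrow>
     master_multipliers \<xi>e \<pi>e r q \<Omega> m \<and> (\<forall>s. pricing_solution lo hi \<xi>e \<pi>e q m s (\<zeta> s))"

definition cg_stops ::
  "real^'m \<Rightarrow> real^'m \<Rightarrow> ('s::finite \<Rightarrow> real^'m) \<Rightarrow> ('s \<Rightarrow> real) \<Rightarrow> real \<Rightarrow> (real^'m \<Rightarrow> real)
    \<Rightarrow> ('s \<Rightarrow> (real^'m) set) \<Rightarrow> bool" where
  "cg_stops lo hi \<xi>e \<pi>e r q \<Omega> \<longleftrightarrow>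
     (\<exists>m \<zeta>. cg_pass lo hi \<xi>e \<pi>e r q \<Omega> m \<zeta> \<and>
        (\<forall>s. pricing_objective \<xi>e \<pi>e q m s (\<zeta> s) \<le> 0))"

text \<open>An iteration that does not stop adds the new scenarios for a nonempty set \<open>T\<close> of indices
  with positive \<open>\<mu>\<close>; both adding all of them and adding a single one are covered.\<close>

definition cg_step ::
  "real^'m \<Rightarrow> real^'m \<Rightarrow> ('s::finite \<Rightarrow> real^'m) \<Rightarrow> ('s \<Rightarrow> real) \<Rightarrow> real \<Rightarrow> (real^'m \<Rightarrow> real)
    \<Rightarrow> ('s \<Rightarrow> (real^'m) set) \<Rightarrow> ('s \<Rightarrow> (real^'m) set) \<Rightarrow> bool" where
  "cg_step lo hi \<xi>e \<pi>e r q \<Omega> \<Omega>' \<longleftrightarrow>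
     (\<exists>m \<zeta> T. cg_pass lo hi \<xi>e \<pi>e r q \<Omega> m \<zeta> \<and>
        T \<noteq> {} \<and> T \<subseteq> {s. 0 < pricing_objective \<xi>e \<pi>e q m s (\<zeta> s)} \<and>
        \<Omega>' = (\<lambda>s. if s \<in> T then \<Omega> s \<union> {\<zeta> s} else \<Omega> s))"

end

theory Submission
  imports Defs
begin

text \<open>Column generation is exact for two reasons. Pricing only ever produces scenarios from a finite
grid, so it must stop; and the multipliers at which it stops form a feasible solution of the dual
of the full worst-case expectation problem, so nothing is lost by having looked at finitely many
scenarios.

\<^bold>\<open>The grid.\<close> The recourse function is convex on the box (\<open>convex_on_recourse\<close>). Along the \<open>i\<close>-th
coordinate, the transport cost to a sample \<open>e\<close> is affine on either side of \<open>e $ i\<close>, so the pricing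
objective is convex on each side and is maximal at an endpoint. Moving the coordinates one after
the other (\<open>grid_point_improves\<close>) leads from any scenario to one with all coordinates among the
lower bound, the upper bound and the sample, without loss. There are at most
\<open>3 ^ CARD('m)\<close> such points per sample. Scenarios that are already available have nonpositive price
by dual feasibility, hence a scenario with positive price is a new grid point
(\<open>cg_step_adds_grid_point\<close>); counting grid points gives the bound on the number of iterations.

\<^bold>\<open>Duality for the master problem.\<close> The budget constraint is the only one that couples the samples.
Without it, an optimal solution would select one scenario per sample. Dualising it leaves a problem with the single multiplier \<open>\<beta>\<close>: the minimum over \<open>\<beta> \<ge> 0\<close>
of a maximum of finitely many affine functions. Fourier-Motzkin elimination of \<open>\<beta>\<close>
(\<open>two_point_duality\<close>) yields optimal multipliers and at the same time a mixture of at most two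
selections with the same value.

\<^bold>\<open>Optimality on stopping.\<close> If no price is positive, the multipliers are dual feasible for all
scenarios of the box. Their dual value bounds the expectation of the recourse function under every
distribution of the ambiguity set: this is Kantorovich duality in its easy direction, with the
function \<open>potential\<close> (\<open>ambiguity_weak_duality\<close>). Conversely, a solution of the
master problem is a finitely supported distribution of the ambiguity set with the same expectation
(\<open>master_solution_distribution\<close>). Strong duality for the master problem closes the chain
(\<open>stationary_dual_solves\<close>). Applied with the whole grid as set of available scenarios, the same
argument shows that a worst-case distribution exists at all.\<close>

section \<open>Linear programming duality with one coupling constraint\<close>

text \<open>Duality for maximising \<open>\<Sum>k\<in>I. x k * a k\<close> over probability weights \<open>x\<close> with \<open>0 \<le> (\<Sum>k\<in>I. x k * b k)\<close>.
The vertices of this problem have at most two positive weights, and among those mixing an index with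
\<open>0 < b i\<close> and one with \<open>b j < 0\<close> only the mixture with \<open>b\<close>-value zero matters. If \<open>M\<close> is the best value
of these finitely many candidates, each index bounds the multiplier \<open>\<beta>\<close> from one side, and the
candidates are exactly what makes the lower bounds compatible with the upper ones.\<close>

lemma two_point_duality:
  fixes a b :: "'i \<Rightarrow> real"
  assumes fin: "finite I" and ex: "\<exists>i\<in>I. 0 \<le> b i"
  obtains \<beta> i j t where "0 \<le> \<beta>" "i \<in> I" "j \<in> I" "0 \<le> t" "t \<le> 1"
    "0 \<le> t * b i + (1 - t) * b j"
    "\<And>k. k \<in> I \<Longrightarrow> a k + b k * \<beta> \<le> t * a i + (1 - t) * a j"
proof -
  \<comment> \<open>value at the mixture of \<open>i\<close> and \<open>j\<close> whose \<open>b\<close>-value is zero\<close>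
  define cross where "cross = (\<lambda>(i, j). (b i * a j - b j * a i) / (b i - b j))"
  define C where "C = a ` {i \<in> I. 0 \<le> b i} \<union> cross ` ({i \<in> I. 0 < b i} \<times> {j \<in> I. b j < 0})"
  define M where "M = Max C"
  have finC: "finite C" and neC: "C \<noteq> {}"
    using fin ex by (auto simp: C_def)
  have leM: "c \<le> M" if "c \<in> C" for c
    using finC that by (simp add: M_def)
  have MC: "M \<in> C"
    using finC neC by (simp add: M_def)
  \<comment> \<open>the largest of the lower bounds on the multiplier, including \<open>0\<close>\<close>
  define \<beta> where "\<beta> = Max (insert 0 ((\<lambda>j. (a j - M) / (- b j)) ` {j \<in> I. b j < 0}))"
  have fin\<beta>: "finite (insert 0 ((\<lambda>j. (a j - M) / (- b j)) ` {j \<in> I. b j < 0}))"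
    using fin by simp
  have \<beta>0: "0 \<le> \<beta>"
    unfolding \<beta>_def using fin\<beta> by (intro Max_ge) auto
  have bound: "a k + b k * \<beta> \<le> M" if k: "k \<in> I" for k
  proof -
    consider "b k < 0" | "b k = 0" | "0 < b k" by linarith
    then show ?thesis
    proof cases
      case 1
      then have "(a k - M) / (- b k) \<le> \<beta>"
        unfolding \<beta>_def using fin\<beta> k by (intro Max_ge) auto
      with 1 show ?thesis by (simp add: field_simps)
    next
      case 2
      then have "a k \<in> C" using k by (auto simp: C_def)
      with 2 leM show ?thesis by simp
    next
      case 3
      have "\<beta> \<le> (M - a k) / b k"
        unfolding \<beta>_def
      proof (subst Max_le_iff[OF fin\<beta>], blast, safe)
        have "a k \<in> C" using 3 k by (auto simp: C_def)
        then show "0 \<le> (M - a k) / b k" using 3 leM by simp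
      next
        fix j assume j: "j \<in> I" "b j < 0"
        then have "cross (k, j) \<in> C" using 3 k by (auto simp: C_def)
        then have "(b k * a j - b j * a k) / (b k - b j) \<le> M"
          using leM by (auto simp: cross_def)
        then have "b k * a j - b j * a k \<le> M * (b k - b j)"
          using 3 j by (simp add: pos_divide_le_eq)
        then have "(a j - M) * b k \<le> (M - a k) * (- b j)"
          by (simp add: algebra_simps)
        moreover have "0 < - b j" using j by simp
        ultimately show "(a j - M) / (- b j) \<le> (M - a k) / b k"
          using 3 by (simp only: pos_divide_le_eq pos_le_divide_eq times_divide_eq_left)
      qed
      with 3 show ?thesis by (simp add: field_simps)
    qed
  qed
  from MC consider i where "i \<in> I" "0 \<le> b i" "M = a i"
    | i j where "i \<in> I" "j \<in> I" "0 < b i" "b j < 0" "M = cross (i, j)"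
    by (auto simp: C_def)
  then show ?thesis
  proof cases
    case 1
    show ?thesis
      by (rule that[of \<beta> i i 1]) (use 1 \<beta>0 bound in auto)
  next
    case 2
    define t where "t = - b j / (b i - b j)"
    have t: "0 \<le> t" "t \<le> 1" "1 - t = b i / (b i - b j)"
      using 2 by (auto simp: t_def field_simps)
    have zero: "t * b i + (1 - t) * b j = 0"
      unfolding t(3) unfolding t_def by (simp add: field_simps)
    have val: "t * a i + (1 - t) * a j = M"
      unfolding t(3) unfolding t_def 2(5) cross_def
      by (simp add: diff_divide_distrib)
    show ?thesis
      by (rule that[of \<beta> i j t]) (use 2 \<beta>0 bound t zero val in auto)
  qed
qed

lemma master_weak_duality:
  assumes p: "master_feasible \<xi>e \<pi>e r \<Omega> p" and m: "dual_feasible \<xi>e \<pi>e q \<Omega> m"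
  shows "master_objective \<pi>e q \<Omega> p \<le> dual_objective r m"
proof -
  obtain \<alpha> \<beta> where mm: "m = (\<alpha>, \<beta>)" by fastforce
  have "master_objective \<pi>e q \<Omega> p
      \<le> (\<Sum>s\<in>UNIV. \<Sum>\<xi>\<in>\<Omega> s. (\<alpha> s + \<pi>e s * norm1 (\<xi> - \<xi>e s) * \<beta>) * p s \<xi>)"
    unfolding master_objective_def
    using p m by (intro sum_mono mult_right_mono) (auto simp: mm dual_feasible_def master_feasible_def)
  also have "\<dots> = (\<Sum>s\<in>UNIV. \<alpha> s * (\<Sum>\<xi>\<in>\<Omega> s. p s \<xi>))
      + \<beta> * (\<Sum>s\<in>UNIV. \<pi>e s * (\<Sum>\<xi>\<in>\<Omega> s. norm1 (\<xi> - \<xi>e s) * p s \<xi>))"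
    by (simp add: sum.distrib sum_distrib_left algebra_simps)
  also have "\<dots> \<le> (\<Sum>s\<in>UNIV. \<alpha> s * 1) + \<beta> * r"
    using p m by (intro add_mono mult_left_mono)
      (auto simp: mm dual_feasible_def master_feasible_def)
  finally show ?thesis by (simp add: mm dual_objective_def mult.commute)
qed

text \<open>A selection picks one scenario per sample. This is the master solution that follows the selection
\<open>f\<close> with probability \<open>t\<close> and the selection \<open>g\<close> otherwise.\<close>

definition mixture :: "real \<Rightarrow> ('s \<Rightarrow> 'a) \<Rightarrow> ('s \<Rightarrow> 'a) \<Rightarrow> 's \<Rightarrow> 'a \<Rightarrow> real" where
  "mixture t f g s \<xi> = t * of_bool (\<xi> = f s) + (1 - t) * of_bool (\<xi> = g s)"

lemma sum_mixture:
  assumes "finite A" "f s \<in> A" "g s \<in> A"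
  shows "(\<Sum>\<xi>\<in>A. c \<xi> * mixture t f g s \<xi>) = t * c (f s) + (1 - t) * c (g s)"
proof -
  have "(\<Sum>\<xi>\<in>A. c \<xi> * mixture t f g s \<xi>) =
      t * (\<Sum>\<xi>\<in>A. if \<xi> = f s then c \<xi> else 0) + (1 - t) * (\<Sum>\<xi>\<in>A. if \<xi> = g s then c \<xi> else 0)"
    unfolding mixture_def sum_distrib_left sum.distrib[symmetric]
    by (intro sum.cong) (auto simp: algebra_simps)
  then show ?thesis
    using assms by (simp add: sum.delta)
qed

lemma master_feasible_mixture:
  assumes fin: "\<And>s. finite (\<Omega> s)" and sel: "\<And>s. f s \<in> \<Omega> s" "\<And>s. g s \<in> \<Omega> s"
    and t: "0 \<le> t" "t \<le> 1"
    and cost: "t * (\<Sum>s\<in>UNIV. \<pi>e s * norm1 (f s - \<xi>e s))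
      + (1 - t) * (\<Sum>s\<in>UNIV. \<pi>e s * norm1 (g s - \<xi>e s)) \<le> r"
  shows "master_feasible \<xi>e \<pi>e r \<Omega> (mixture t f g)"
  unfolding master_feasible_def
proof (intro conjI allI ballI)
  show "0 \<le> mixture t f g s \<xi>" for s \<xi>
    using t by (simp add: mixture_def)
  show "(\<Sum>\<xi>\<in>\<Omega> s. mixture t f g s \<xi>) = 1" for s
    using sum_mixture[where c = "\<lambda>_. 1" and f = f and g = g, OF fin sel] by simp
  show "(\<Sum>s\<in>UNIV. \<pi>e s * (\<Sum>\<xi>\<in>\<Omega> s. norm1 (\<xi> - \<xi>e s) * mixture t f g s \<xi>)) \<le> r"
  proof -
    have "(\<Sum>s\<in>UNIV. \<pi>e s * (\<Sum>\<xi>\<in>\<Omega> s. norm1 (\<xi> - \<xi>e s) * mixture t f g s \<xi>))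
        = (\<Sum>s\<in>UNIV. t * (\<pi>e s * norm1 (f s - \<xi>e s)) + (1 - t) * (\<pi>e s * norm1 (g s - \<xi>e s)))"
      by (intro sum.cong refl) (simp add: sum_mixture fin sel algebra_simps)
    then show ?thesis
      using cost by (simp add: sum.distrib sum_distrib_left)
  qed
qed

lemma master_objective_mixture:
  assumes fin: "\<And>s. finite (\<Omega> s)" and sel: "\<And>s. f s \<in> \<Omega> s" "\<And>s. g s \<in> \<Omega> s"
  shows "master_objective \<pi>e q \<Omega> (mixture t f g) =
    t * (\<Sum>s\<in>UNIV. \<pi>e s * q (f s)) + (1 - t) * (\<Sum>s\<in>UNIV. \<pi>e s * q (g s))"
proof -
  have "master_objective \<pi>e q \<Omega> (mixture t f g)
      = (\<Sum>s\<in>UNIV. t * (\<pi>e s * q (f s)) + (1 - t) * (\<pi>e s * q (g s)))"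
    unfolding master_objective_def by (intro sum.cong refl) (intro sum_mixture fin sel)
  then show ?thesis by (simp add: sum.distrib sum_distrib_left)
qed

text \<open>The selection of nearest scenarios is the cheapest master solution, so it decides whether the master
problem is feasible.\<close>

lemma nearest_selection:
  assumes fin: "\<And>s. finite (\<Omega> s)" and ne: "\<And>s. \<Omega> s \<noteq> {}"
  obtains f where "\<And>s. f s \<in> \<Omega> s"
    "\<And>s \<xi>. \<xi> \<in> \<Omega> s \<Longrightarrow> \<pi>e s * norm1 (f s - \<xi>e s) \<le> \<pi>e s * norm1 (\<xi> - \<xi>e s)"
proof -
  have "\<exists>\<zeta>\<in>\<Omega> s. \<forall>\<xi>\<in>\<Omega> s. \<pi>e s * norm1 (\<zeta> - \<xi>e s) \<le> \<pi>e s * norm1 (\<xi> - \<xi>e s)" for s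
    using arg_min_if_finite(1)[OF fin[of s] ne[of s], of "\<lambda>\<xi>. \<pi>e s * norm1 (\<xi> - \<xi>e s)"]
      arg_min_least[OF fin[of s] ne[of s], where f = "\<lambda>\<xi>. \<pi>e s * norm1 (\<xi> - \<xi>e s)"] by blast
  then show ?thesis using that by metis
qed

lemma nearest_selection_cost:
  assumes p: "master_feasible \<xi>e \<pi>e r \<Omega> p"
    and f: "\<And>s \<xi>. \<xi> \<in> \<Omega> s \<Longrightarrow> \<pi>e s * norm1 (f s - \<xi>e s) \<le> \<pi>e s * norm1 (\<xi> - \<xi>e s)"
  shows "(\<Sum>s\<in>UNIV. \<pi>e s * norm1 (f s - \<xi>e s)) \<le> r"
proof -
  have "(\<Sum>s\<in>UNIV. \<pi>e s * norm1 (f s - \<xi>e s))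
      = (\<Sum>s\<in>UNIV. \<Sum>\<xi>\<in>\<Omega> s. \<pi>e s * norm1 (f s - \<xi>e s) * p s \<xi>)"
    using p by (simp add: master_feasible_def sum_distrib_left[symmetric])
  also have "\<dots> \<le> (\<Sum>s\<in>UNIV. \<Sum>\<xi>\<in>\<Omega> s. \<pi>e s * norm1 (\<xi> - \<xi>e s) * p s \<xi>)"
    using p f by (intro sum_mono mult_right_mono) (auto simp: master_feasible_def)
  also have "\<dots> \<le> r"
    using p by (simp add: master_feasible_def sum_distrib_left mult.assoc)
  finally show ?thesis .
qed

lemma master_feasible_nonempty:
  "master_feasible \<xi>e \<pi>e r \<Omega> p \<Longrightarrow> \<Omega> s \<noteq> {}"
  unfolding master_feasible_def by (metis sum.empty zero_neq_one)

text \<open>The indices of the reduced problem are the selections, with the slack of the budget as the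
coupling value. For a given \<open>\<beta>\<close>, the cheapest feasible \<open>\<alpha>\<close> belongs to the selection of scenarios with
maximal reduced price, so the bound on all selections becomes a bound on the dual objective.\<close>

lemma master_strong_duality:
  fixes \<Omega> :: "'s::finite \<Rightarrow> (real^'m) set"
  assumes fin: "\<And>s. finite (\<Omega> s)" and feas: "master_feasible \<xi>e \<pi>e r \<Omega> p0"
  obtains p m where "master_feasible \<xi>e \<pi>e r \<Omega> p" "dual_feasible \<xi>e \<pi>e q \<Omega> m"
    "dual_objective r m = master_objective \<pi>e q \<Omega> p"
proof -
  define I where "I = {f. \<forall>s. f s \<in> \<Omega> s}"
  define a where "a f = (\<Sum>s\<in>UNIV. \<pi>e s * q (f s))" for f :: "'s \<Rightarrow> real^'m"
  define b where "b f = r - (\<Sum>s\<in>UNIV. \<pi>e s * norm1 (f s - \<xi>e s))" for f :: "'s \<Rightarrow> real^'m"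
  have ne: "\<Omega> s \<noteq> {}" for s
    by (rule master_feasible_nonempty[OF feas])
  have "I = PiE UNIV \<Omega>"
    by (auto simp: I_def PiE_UNIV_domain)
  then have finI: "finite I"
    using fin by (simp add: finite_PiE)
  obtain n where n: "\<And>s. n s \<in> \<Omega> s"
    "\<And>s \<xi>. \<xi> \<in> \<Omega> s \<Longrightarrow> \<pi>e s * norm1 (n s - \<xi>e s) \<le> \<pi>e s * norm1 (\<xi> - \<xi>e s)"
    using nearest_selection[where \<Omega> = \<Omega> and \<pi>e = \<pi>e and \<xi>e = \<xi>e, OF fin ne] by metis
  have "\<exists>f\<in>I. 0 \<le> b f"
    using n(1) nearest_selection_cost[OF feas n(2)] by (auto simp: I_def b_def)
  then obtain \<beta> f g t where \<beta>: "0 \<le> \<beta>" and fg: "f \<in> I" "g \<in> I" and t: "0 \<le> t" "t \<le> 1"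
    and cost: "0 \<le> t * b f + (1 - t) * b g"
    and opt: "\<And>k. k \<in> I \<Longrightarrow> a k + b k * \<beta> \<le> t * a f + (1 - t) * a g"
    using two_point_duality[OF finI, where a = a and b = b] by metis
  have p: "master_feasible \<xi>e \<pi>e r \<Omega> (mixture t f g)"
    using fg cost by (intro master_feasible_mixture fin t) (auto simp: I_def b_def algebra_simps)
  have val: "master_objective \<pi>e q \<Omega> (mixture t f g) = t * a f + (1 - t) * a g"
    using fg fin by (simp add: master_objective_mixture I_def a_def)
  define price where "price s \<xi> = \<pi>e s * q \<xi> - \<pi>e s * norm1 (\<xi> - \<xi>e s) * \<beta>" for s \<xi>
  have "\<exists>\<zeta>\<in>\<Omega> s. \<forall>\<xi>\<in>\<Omega> s. price s \<xi> \<le> price s \<zeta>" for s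
    using arg_min_if_finite(1)[OF fin[of s] ne[of s], of "\<lambda>\<xi>. - price s \<xi>"]
      arg_min_least[OF fin[of s] ne[of s], where f = "\<lambda>\<xi>. - price s \<xi>"]
    by (metis neg_le_iff_le)
  then obtain k where k: "\<And>s. k s \<in> \<Omega> s" "\<And>s \<xi>. \<xi> \<in> \<Omega> s \<Longrightarrow> price s \<xi> \<le> price s (k s)"
    by metis
  define m where "m = (\<lambda>s. price s (k s), \<beta>)"
  have m: "dual_feasible \<xi>e \<pi>e q \<Omega> m"
    using k(2) \<beta> by (fastforce simp: m_def dual_feasible_def price_def)
  have "dual_objective r m = a k + b k * \<beta>"
    by (simp add: m_def dual_objective_def price_def a_def b_def sum_subtractf sum_distrib_left
        algebra_simps)
  also have "\<dots> \<le> master_objective \<pi>e q \<Omega> (mixture t f g)"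
    unfolding val using k(1) by (intro opt) (simp add: I_def)
  finally show ?thesis
    using that[OF p m] master_weak_duality[OF p m] by simp
qed

text \<open>A sample without scenarios leaves its \<open>\<alpha>\<close> unconstrained. Otherwise even the nearest selection exceeds
the budget, and the dual objective decreases without bound as \<open>\<beta>\<close> grows.\<close>

lemma infeasible_master_dual_unbounded:
  fixes \<Omega> :: "'s::finite \<Rightarrow> (real^'m) set"
  assumes fin: "\<And>s. finite (\<Omega> s)" and infeas: "\<nexists>p. master_feasible \<xi>e \<pi>e r \<Omega> p"
  obtains m where "dual_feasible \<xi>e \<pi>e q \<Omega> m" "dual_objective r m < c"
proof -
  have "\<exists>u. \<forall>\<xi>\<in>\<Omega> s. \<pi>e s * q \<xi> \<le> u" for s
    using fin[of s] bdd_above_finite[of "(\<lambda>\<xi>. \<pi>e s * q \<xi>) ` \<Omega> s"] by (auto simp: bdd_above_def)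
  then obtain u where u: "\<And>s \<xi>. \<xi> \<in> \<Omega> s \<Longrightarrow> \<pi>e s * q \<xi> \<le> u s"
    by metis
  show ?thesis
  proof (cases "\<exists>s. \<Omega> s = {}")
    case True
    then obtain s0 where s0: "\<Omega> s0 = {}" by blast
    define \<alpha> where "\<alpha> = u(s0 := c - 1 - sum u (UNIV - {s0}))"
    have "sum \<alpha> UNIV = \<alpha> s0 + sum \<alpha> (UNIV - {s0})"
      by (simp add: sum.remove)
    also have "sum \<alpha> (UNIV - {s0}) = sum u (UNIV - {s0})"
      by (intro sum.cong) (auto simp: \<alpha>_def)
    finally have "sum \<alpha> UNIV = c - 1"
      by (simp add: \<alpha>_def)
    then show ?thesis
      by (intro that[of "(\<alpha>, 0)"]) (auto simp: dual_feasible_def dual_objective_def \<alpha>_def s0 u)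
  next
    case False
    then have ne: "\<Omega> s \<noteq> {}" for s by blast
    obtain n where n: "\<And>s. n s \<in> \<Omega> s"
      "\<And>s \<xi>. \<xi> \<in> \<Omega> s \<Longrightarrow> \<pi>e s * norm1 (n s - \<xi>e s) \<le> \<pi>e s * norm1 (\<xi> - \<xi>e s)"
      using nearest_selection[where \<Omega> = \<Omega> and \<pi>e = \<pi>e and \<xi>e = \<xi>e, OF fin ne] by metis
    define W where "W = (\<Sum>s\<in>UNIV. \<pi>e s * norm1 (n s - \<xi>e s))"
    have "r < W"
    proof (rule ccontr)
      assume "\<not> r < W"
      then have "master_feasible \<xi>e \<pi>e r \<Omega> (mixture 1 n n)"
        by (intro master_feasible_mixture fin n) (auto simp: W_def)
      with infeas show False by blast
    qed
    \<comment> \<open>large enough to bring the dual value below \<open>c\<close>\<close>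
    define \<beta> where "\<beta> = (\<bar>sum u UNIV - c\<bar> + 1) / (W - r)"
    have \<beta>: "0 \<le> \<beta>" "\<beta> * (W - r) = \<bar>sum u UNIV - c\<bar> + 1"
      using \<open>r < W\<close> by (auto simp: \<beta>_def)
    define \<alpha> where "\<alpha> s = u s - \<beta> * (\<pi>e s * norm1 (n s - \<xi>e s))" for s
    have "\<pi>e s * q \<xi> \<le> \<alpha> s + \<pi>e s * norm1 (\<xi> - \<xi>e s) * \<beta>" if "\<xi> \<in> \<Omega> s" for s \<xi>
      using u[OF that] mult_left_mono[OF n(2)[OF that] \<beta>(1)] by (simp add: \<alpha>_def algebra_simps)
    then have "dual_feasible \<xi>e \<pi>e q \<Omega> (\<alpha>, \<beta>)"
      using \<beta> by (auto simp: dual_feasible_def)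
    moreover have "dual_objective r (\<alpha>, \<beta>) = sum u UNIV - \<beta> * (W - r)"
      by (simp add: dual_objective_def \<alpha>_def sum_subtractf sum_distrib_left W_def algebra_simps)
    ultimately show ?thesis
      using \<beta>(2) by (intro that) auto
  qed
qed

lemma master_multipliers_exist:
  fixes \<Omega> :: "'s::finite \<Rightarrow> (real^'m) set"
  assumes fin: "\<And>s. finite (\<Omega> s)"
  shows "\<exists>m. master_multipliers \<xi>e \<pi>e r q \<Omega> m"
proof (cases "\<exists>p. master_feasible \<xi>e \<pi>e r \<Omega> p")
  case True
  then obtain p0 where "master_feasible \<xi>e \<pi>e r \<Omega> p0" by blast
  then obtain p m where "master_feasible \<xi>e \<pi>e r \<Omega> p" "dual_feasible \<xi>e \<pi>e q \<Omega> m"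
    "dual_objective r m = master_objective \<pi>e q \<Omega> p"
    by (rule master_strong_duality[OF fin])
  then have "is_arg_min (dual_objective r) (dual_feasible \<xi>e \<pi>e q \<Omega>) m"
    using master_weak_duality by (metis is_arg_min_linorder)
  with True show ?thesis unfolding master_multipliers_def by metis
next
  case False
  then show ?thesis
    using infeasible_master_dual_unbounded[OF fin False]
    unfolding master_multipliers_def by metis
qed

lemma master_optimal_value:
  assumes fin: "\<And>s. finite (\<Omega> s)" and feas: "master_feasible \<xi>e \<pi>e r \<Omega> p0"
    and m: "is_arg_min (dual_objective r) (dual_feasible \<xi>e \<pi>e q \<Omega>) m"
  obtains p where "is_arg_max (master_objective \<pi>e q \<Omega>) (master_feasible \<xi>e \<pi>e r \<Omega>) p"
    "master_objective \<pi>e q \<Omega> p = dual_objective r m"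
proof -
  obtain p m' where p: "master_feasible \<xi>e \<pi>e r \<Omega> p" and m': "dual_feasible \<xi>e \<pi>e q \<Omega> m'"
    "dual_objective r m' = master_objective \<pi>e q \<Omega> p"
    using fin feas by (rule master_strong_duality)
  have md: "dual_feasible \<xi>e \<pi>e q \<Omega> m" "dual_objective r m \<le> dual_objective r m'"
    using m m' by (auto simp: is_arg_min_linorder simp del: split_paired_All)
  then have eq: "master_objective \<pi>e q \<Omega> p = dual_objective r m"
    using master_weak_duality[OF p md(1)] m' by simp
  show ?thesis
    using p md(1) eq
    by (intro that[of p]) (auto simp: is_arg_max_def not_less intro: master_weak_duality)
qed

section \<open>The recourse function\<close>

lemma recourse_le:
  assumes "relatively_complete_recourse d F h G K X \<Xi>" "x \<in> X" "\<xi> \<in> \<Xi>"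
    "y \<in> recourse_feasible F h G K x \<xi>"
  shows "recourse d F h G K x \<xi> \<le> d \<bullet> y"
  unfolding recourse_def
  using assms by (intro cINF_lower) (auto simp: relatively_complete_recourse_def)

lemma recourse_less_iff:
  assumes "relatively_complete_recourse d F h G K X \<Xi>" "x \<in> X" "\<xi> \<in> \<Xi>"
  shows "recourse d F h G K x \<xi> < c \<longleftrightarrow> (\<exists>y\<in>recourse_feasible F h G K x \<xi>. d \<bullet> y < c)"
  unfolding recourse_def
  using assms by (intro cINF_less_iff) (auto simp: relatively_complete_recourse_def)

lemma recourse_feasible_convex:
  assumes y: "y \<in> recourse_feasible F h G K x \<xi>" and z: "z \<in> recourse_feasible F h G K x \<zeta>"
    and uv: "0 \<le> u" "0 \<le> v" "u + v = 1"
  shows "u *\<^sub>R y + v *\<^sub>R z \<in> recourse_feasible F h G K x (u *\<^sub>R \<xi> + v *\<^sub>R \<zeta>)"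
proof -
  let ?k = "h - G *v x"
  have y': "0 \<le> y" "F *v y \<le> ?k - K *v \<xi>" and z': "0 \<le> z" "F *v z \<le> ?k - K *v \<zeta>"
    using y z by (auto simp: recourse_feasible_def)
  have "F *v (u *\<^sub>R y + v *\<^sub>R z) = u *\<^sub>R (F *v y) + v *\<^sub>R (F *v z)"
    by (simp add: matrix_vector_right_distrib matrix_vector_mult_scaleR)
  also have "\<dots> \<le> u *\<^sub>R (?k - K *v \<xi>) + v *\<^sub>R (?k - K *v \<zeta>)"
    using y' z' uv by (intro add_mono scaleR_left_mono) auto
  also have "\<dots> = (u + v) *\<^sub>R ?k - K *v (u *\<^sub>R \<xi> + v *\<^sub>R \<zeta>)"
    by (simp add: matrix_vector_right_distrib matrix_vector_mult_scaleR algebra_simps)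
  finally show ?thesis
    using y' z' uv by (auto simp: recourse_feasible_def intro!: add_nonneg_nonneg scaleR_nonneg_nonneg)
qed

text \<open>Combining nearly optimal recourse decisions of two scenarios gives a feasible decision for the
combined scenario, at the combined cost.\<close>

lemma convex_on_recourse:
  fixes \<Xi> :: "(real^'m) set"
  assumes rec: "relatively_complete_recourse d F h G K X \<Xi>" and x: "x \<in> X" and "convex \<Xi>"
  shows "convex_on \<Xi> (recourse d F h G K x)"
proof (rule convex_onI)
  let ?q = "recourse d F h G K x"
  fix t :: real and \<xi> \<zeta> assume t: "0 < t" "t < 1" and \<Xi>: "\<xi> \<in> \<Xi>" "\<zeta> \<in> \<Xi>"
  have mix: "(1 - t) *\<^sub>R \<xi> + t *\<^sub>R \<zeta> \<in> \<Xi>"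
    using \<open>convex \<Xi>\<close> \<Xi> t by (auto simp: convex_def)
  show "?q ((1 - t) *\<^sub>R \<xi> + t *\<^sub>R \<zeta>) \<le> (1 - t) * ?q \<xi> + t * ?q \<zeta>"
  proof (rule field_le_epsilon)
    fix \<epsilon> :: real assume "0 < \<epsilon>"
    obtain y z where y: "y \<in> recourse_feasible F h G K x \<xi>" "d \<bullet> y < ?q \<xi> + \<epsilon>"
      and z: "z \<in> recourse_feasible F h G K x \<zeta>" "d \<bullet> z < ?q \<zeta> + \<epsilon>"
      using recourse_less_iff[OF rec x \<Xi>(1), of "?q \<xi> + \<epsilon>"]
        recourse_less_iff[OF rec x \<Xi>(2), of "?q \<zeta> + \<epsilon>"] \<open>0 < \<epsilon>\<close> by auto
    have "?q ((1 - t) *\<^sub>R \<xi> + t *\<^sub>R \<zeta>) \<le> d \<bullet> ((1 - t) *\<^sub>R y + t *\<^sub>R z)"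
      using t by (intro recourse_le[OF rec x mix] recourse_feasible_convex y z) auto
    also have "\<dots> = (1 - t) * (d \<bullet> y) + t * (d \<bullet> z)"
      by (simp add: inner_add_right)
    also have "\<dots> \<le> (1 - t) * (?q \<xi> + \<epsilon>) + t * (?q \<zeta> + \<epsilon>)"
      using t y z by (intro add_mono mult_left_mono) auto
    also have "\<dots> = (1 - t) * ?q \<xi> + t * ?q \<zeta> + \<epsilon>"
      by (simp add: algebra_simps)
    finally show "?q ((1 - t) *\<^sub>R \<xi> + t *\<^sub>R \<zeta>) \<le> (1 - t) * ?q \<xi> + t * ?q \<zeta> + \<epsilon>" .
  qed
qed fact

text \<open>Closedness makes the bounded pieces of this graph compact, and hence their projections Borel.\<close>

lemma closed_recourse_graph:
  fixes F :: "real^'y^'l" and K :: "real^'m^'l"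
  shows "closed {(\<xi>, y). y \<in> recourse_feasible F h G K x \<xi>}"
proof -
  have "{(\<xi>, y). y \<in> recourse_feasible F h G K x \<xi>} =
     {z. \<forall>i. 0 \<le> snd z $ i} \<inter> {z. \<forall>i. (F *v snd z) $ i \<le> (h - G *v x - K *v fst z) $ i}"
    by (auto simp: recourse_feasible_def less_eq_vec_def)
  also have "closed \<dots>"
    by (intro closed_Int closed_Collect_all closed_Collect_le continuous_intros
        continuous_on_component matrix_vector_mult_linear_continuous_on
        continuous_on_compose2[OF matrix_vector_mult_linear_continuous_on]) auto
  finally show ?thesis .
qed

text \<open>A strict sublevel set is a countable union of projections of compact sets: bound the norm of the
recourse decision by \<open>M\<close>, and its cost by \<open>c - 1 / (N + 1)\<close>.\<close>

lemma borel_measurable_recourse: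
  fixes \<Xi> :: "(real^'m) set"
  assumes rec: "relatively_complete_recourse d F h G K X \<Xi>" and x: "x \<in> X" and "compact \<Xi>"
  shows "recourse d F h G K x \<in> borel_measurable (restrict_space borel \<Xi>)"
proof (rule borel_measurable_iff_less[THEN iffD2], rule allI)
  fix c
  let ?q = "recourse d F h G K x"
  define Z where "Z M N = \<Xi> \<times> cball 0 (real M) \<inter> {(\<xi>, y). y \<in> recourse_feasible F h G K x \<xi>}
     \<inter> {z. d \<bullet> snd z \<le> c - 1 / real (Suc N)}" for M N
  have "compact (Z M N)" for M N
    unfolding Z_def
    by (intro compact_Int_closed compact_Times \<open>compact \<Xi>\<close> compact_cball closed_recourse_graph
        closed_Collect_le continuous_intros)
  then have "compact (fst ` Z M N)" for M N
    by (intro compact_continuous_image continuous_intros)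
  then have borel: "(\<Union>M N. fst ` Z M N) \<in> sets borel"
    by (intro sets.countable_UN borel_compact image_subsetI) (auto intro: borel_compact)
  have level: "{\<xi> \<in> \<Xi>. ?q \<xi> < c} = (\<Union>M N. fst ` Z M N)"
  proof (intro set_eqI iffI)
    fix \<xi> assume "\<xi> \<in> {\<xi> \<in> \<Xi>. ?q \<xi> < c}"
    then obtain y where y: "\<xi> \<in> \<Xi>" "y \<in> recourse_feasible F h G K x \<xi>" "d \<bullet> y < c"
      using recourse_less_iff[OF rec x] by auto
    obtain M where M: "norm y \<le> real M" using real_arch_simple by blast
    obtain N where "1 / real (Suc N) < c - d \<bullet> y"
      using y(3) nat_approx_posE[of "c - d \<bullet> y"] by auto
    then have "(\<xi>, y) \<in> Z M N" using y M by (simp add: Z_def)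
    then show "\<xi> \<in> (\<Union>M N. fst ` Z M N)" by force
  next
    fix \<xi> assume "\<xi> \<in> (\<Union>M N. fst ` Z M N)"
    then obtain M N y where y: "(\<xi>, y) \<in> Z M N" by auto
    have N: "0 < 1 / real (Suc N)" by simp
    from y have "\<xi> \<in> \<Xi>" "y \<in> recourse_feasible F h G K x \<xi>" "d \<bullet> y \<le> c - 1 / real (Suc N)"
      unfolding Z_def by (auto simp del: of_nat_Suc)
    moreover from this(3) N have "d \<bullet> y < c" by linarith
    ultimately have "\<xi> \<in> \<Xi>" "y \<in> recourse_feasible F h G K x \<xi>" "d \<bullet> y < c" by auto
    then show "\<xi> \<in> {\<xi> \<in> \<Xi>. ?q \<xi> < c}"
      using recourse_less_iff[OF rec x] by auto
  qed
  then have "{w \<in> space (restrict_space borel \<Xi>). ?q w < c} = \<Xi> \<inter> (\<Union>M N. fst ` Z M N)"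
    by (auto simp: space_restrict_space)
  then show "{w \<in> space (restrict_space borel \<Xi>). ?q w < c} \<in> sets (restrict_space borel \<Xi>)"
    using borel by (auto simp: sets_restrict_space)
qed

section \<open>Pricing and the grid of scenarios\<close>

lemma norm1_nonneg: "0 \<le> norm1 v"
  by (simp add: norm1_def sum_nonneg)

lemma continuous_on_norm1 [continuous_intros]:
  "continuous_on S f \<Longrightarrow> continuous_on S (\<lambda>x. norm1 (f x))"
  unfolding norm1_def by (intro continuous_intros)

definition set_coord :: "'m \<Rightarrow> real \<Rightarrow> real^'m \<Rightarrow> real^'m" where
  "set_coord i t \<xi> = (\<chi> j. if j = i then t else \<xi> $ j)"

lemma set_coord_nth [simp]: "set_coord i t \<xi> $ j = (if j = i then t else \<xi> $ j)"
  by (simp add: set_coord_def)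

lemma norm1_set_coord:
  "norm1 (set_coord i t \<xi> - e) = \<bar>t - e $ i\<bar> + (\<Sum>j\<in>UNIV - {i}. \<bar>\<xi> $ j - e $ j\<bar>)"
  unfolding norm1_def by (subst sum.remove[of _ i]) (auto intro!: sum.cong)

text \<open>On an interval that has \<open>e $ i\<close> on one side, the transport cost is affine in the coordinate \<open>i\<close>, so
subtracting a multiple of it keeps the objective convex there.\<close>

lemma set_coord_endpoint_improves:
  fixes \<xi> e lo hi :: "real^'m"
  assumes q: "convex_on (cbox lo hi) q" and \<xi>: "\<xi> \<in> cbox lo hi"
    and ab: "lo $ i \<le> a" "a \<le> \<xi> $ i" "\<xi> $ i \<le> b" "b \<le> hi $ i"
    and side: "b \<le> e $ i \<or> e $ i \<le> a"
  shows "\<exists>t\<in>{a, b}. q \<xi> - \<beta> * norm1 (\<xi> - e)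
           \<le> q (set_coord i t \<xi>) - \<beta> * norm1 (set_coord i t \<xi> - e)"
proof (cases "a = b")
  case True
  then have "set_coord i a \<xi> = \<xi>" using ab by (simp add: vec_eq_iff)
  then show ?thesis by auto
next
  case False
  define \<phi> where "\<phi> \<xi> = q \<xi> - \<beta> * norm1 (\<xi> - e)" for \<xi>
  define v where "v = (\<xi> $ i - a) / (b - a)"
  have v: "0 \<le> v" "v \<le> 1" and "v * (b - a) = \<xi> $ i - a"
    using False ab by (auto simp: v_def)
  then have xi: "\<xi> $ i = (1 - v) * a + v * b"
    by (simp add: algebra_simps)
  let ?A = "set_coord i a \<xi>" and ?B = "set_coord i b \<xi>"
  have box: "?A \<in> cbox lo hi" "?B \<in> cbox lo hi"
    using \<xi> ab by (auto simp: mem_box_cart)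
  have comb: "\<xi> = (1 - v) *\<^sub>R ?A + v *\<^sub>R ?B"
    using xi by (simp add: vec_eq_iff algebra_simps)
  have "q \<xi> \<le> (1 - v) * q ?A + v * q ?B"
    using convex_onD[OF q v box] comb by simp
  moreover have "norm1 (\<xi> - e) = (1 - v) * norm1 (?A - e) + v * norm1 (?B - e)"
  proof -
    have "\<xi> = set_coord i (\<xi> $ i) \<xi>" by (simp add: vec_eq_iff)
    then have "norm1 (\<xi> - e) = \<bar>\<xi> $ i - e $ i\<bar> + (\<Sum>j\<in>UNIV - {i}. \<bar>\<xi> $ j - e $ j\<bar>)"
      using norm1_set_coord[of i "\<xi> $ i" \<xi> e] by simp
    moreover have "\<bar>\<xi> $ i - e $ i\<bar> = (1 - v) * \<bar>a - e $ i\<bar> + v * \<bar>b - e $ i\<bar>"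
      using side
    proof
      assume "b \<le> e $ i"
      then have "\<bar>\<xi> $ i - e $ i\<bar> = e $ i - \<xi> $ i" "\<bar>a - e $ i\<bar> = e $ i - a" "\<bar>b - e $ i\<bar> = e $ i - b"
        using ab by auto
      then show ?thesis using xi by (simp add: algebra_simps)
    next
      assume "e $ i \<le> a"
      then have "\<bar>\<xi> $ i - e $ i\<bar> = \<xi> $ i - e $ i" "\<bar>a - e $ i\<bar> = a - e $ i" "\<bar>b - e $ i\<bar> = b - e $ i"
        using ab by auto
      then show ?thesis using xi by (simp add: algebra_simps)
    qed
    ultimately show ?thesis
      by (simp add: norm1_set_coord algebra_simps)
  qed
  ultimately have "\<phi> \<xi> \<le> (1 - v) * q ?A + v * q ?B
      - \<beta> * ((1 - v) * norm1 (?A - e) + v * norm1 (?B - e))"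
    by (simp add: \<phi>_def)
  also have "\<dots> = (1 - v) * \<phi> ?A + v * \<phi> ?B"
    by (simp add: \<phi>_def algebra_simps)
  also have "\<dots> \<le> max (\<phi> ?A) (\<phi> ?B)"
    using v by (intro convex_bound_le) auto
  finally show ?thesis by (auto simp: \<phi>_def max_def split: if_splits)
qed

text \<open>The possible outcomes of the mixed-integer form of the pricing problem for the sample \<open>e\<close>.\<close>

definition grid :: "real^'m \<Rightarrow> real^'m \<Rightarrow> real^'m \<Rightarrow> (real^'m) set" where
  "grid lo hi e = {\<xi>. \<forall>i. \<xi> $ i \<in> {hi $ i, lo $ i, e $ i}}"

lemma grid_finite_card:
  fixes lo hi e :: "real^'m"
  shows "finite (grid lo hi e)" "card (grid lo hi e) \<le> 3 ^ CARD('m)"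
proof -
  define B where "B = PiE UNIV (\<lambda>i. {hi $ i, lo $ i, e $ i})"
  have sub: "vec_nth ` grid lo hi e \<subseteq> B"
    by (auto simp: B_def grid_def)
  have inj: "inj_on vec_nth (grid lo hi e)"
    by (auto simp: inj_on_def vec_nth_inject)
  have finB: "finite B" by (simp add: B_def finite_PiE)
  show "finite (grid lo hi e)"
    using finB inj sub by (metis finite_imageD finite_subset)
  have "card (grid lo hi e) \<le> card B"
    by (rule card_inj_on_le[OF inj sub finB])
  also have "\<dots> = (\<Prod>i\<in>UNIV. card {hi $ i, lo $ i, e $ i})"
    by (simp add: B_def card_PiE)
  also have "\<dots> \<le> (\<Prod>i\<in>(UNIV :: 'm set). 3)"
    by (intro prod_mono) (auto simp: card_insert_if)
  finally show "card (grid lo hi e) \<le> 3 ^ CARD('m)" by simp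
qed

lemma grid_subset_box:
  "e \<in> cbox lo hi \<Longrightarrow> grid lo hi e \<subseteq> cbox lo hi"
  unfolding grid_def mem_box_cart subset_iff by (smt (verit) insert_iff mem_Collect_eq singletonD)

text \<open>Moving one coordinate at a time keeps the grid coordinates that were reached before.\<close>

lemma grid_point_improves:
  fixes \<xi> e lo hi :: "real^'m"
  assumes q: "convex_on (cbox lo hi) q" and e: "e \<in> cbox lo hi" and \<xi>: "\<xi> \<in> cbox lo hi"
  obtains \<zeta> where "\<zeta> \<in> grid lo hi e" "q \<xi> - \<beta> * norm1 (\<xi> - e) \<le> q \<zeta> - \<beta> * norm1 (\<zeta> - e)"
proof -
  have "\<exists>\<zeta>\<in>cbox lo hi. (\<forall>i\<in>J. \<zeta> $ i \<in> {hi $ i, lo $ i, e $ i}) \<and>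
          q \<xi> - \<beta> * norm1 (\<xi> - e) \<le> q \<zeta> - \<beta> * norm1 (\<zeta> - e)" if "finite J" for J
    using that
  proof (induction J)
    case empty
    then show ?case using \<xi> by auto
  next
    case (insert i J)
    then obtain \<zeta> where \<zeta>: "\<zeta> \<in> cbox lo hi" "\<forall>j\<in>J. \<zeta> $ j \<in> {hi $ j, lo $ j, e $ j}"
      "q \<xi> - \<beta> * norm1 (\<xi> - e) \<le> q \<zeta> - \<beta> * norm1 (\<zeta> - e)"
      by blast
    have bds: "lo $ i \<le> \<zeta> $ i" "\<zeta> $ i \<le> hi $ i" "lo $ i \<le> e $ i" "e $ i \<le> hi $ i"
      using \<zeta>(1) e by (auto simp: mem_box_cart)
    obtain t where t: "t \<in> {hi $ i, lo $ i, e $ i}"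
      "q \<zeta> - \<beta> * norm1 (\<zeta> - e) \<le> q (set_coord i t \<zeta>) - \<beta> * norm1 (set_coord i t \<zeta> - e)"
    proof (cases "\<zeta> $ i \<le> e $ i")
      case True
      then show ?thesis
        using set_coord_endpoint_improves[OF q \<zeta>(1), of i "lo $ i" "e $ i" e \<beta>] bds that by auto
    next
      case False
      then show ?thesis
        using set_coord_endpoint_improves[OF q \<zeta>(1), of i "e $ i" "hi $ i" e \<beta>] bds that by auto
    qed
    have "set_coord i t \<zeta> \<in> cbox lo hi"
      using \<zeta>(1) t(1) bds by (auto simp: mem_box_cart)
    moreover have "\<forall>j\<in>insert i J. set_coord i t \<zeta> $ j \<in> {hi $ j, lo $ j, e $ j}"
      using \<zeta>(2) t(1) by auto
    ultimately show ?case
      using \<zeta>(3) t(2) by (intro bexI[of _ "set_coord i t \<zeta>"]) auto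
  qed
  from this[of UNIV] show ?thesis
    using that by (auto simp: grid_def)
qed

lemma pricing_objective_nonpos_iff:
  "pricing_objective \<xi>e \<pi>e q (\<alpha>, \<beta>) s \<xi> \<le> 0
    \<longleftrightarrow> \<pi>e s * q \<xi> \<le> \<alpha> s + \<pi>e s * norm1 (\<xi> - \<xi>e s) * \<beta>"
  by (simp add: pricing_objective_def algebra_simps)

lemma pricing_solution_exists:
  assumes q: "convex_on (cbox lo hi) q" and e: "\<xi>e s \<in> cbox lo hi" and \<pi>: "0 \<le> \<pi>e s"
  shows "\<exists>\<zeta>. pricing_solution lo hi \<xi>e \<pi>e q m s \<zeta>"
proof -
  obtain \<alpha> \<beta> where m: "m = (\<alpha>, \<beta>)" by fastforce
  let ?o = "pricing_objective \<xi>e \<pi>e q m s" and ?G = "grid lo hi (\<xi>e s)"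
  have ne: "?G \<noteq> {}" by (auto simp: grid_def)
  then obtain \<zeta> where \<zeta>: "\<zeta> \<in> ?G" "\<forall>\<xi>\<in>?G. ?o \<xi> \<le> ?o \<zeta>"
    using arg_min_if_finite(1)[OF grid_finite_card(1) ne, of "\<lambda>\<xi>. - ?o \<xi>"]
      arg_min_least[OF grid_finite_card(1) ne, of _ "\<lambda>\<xi>. - ?o \<xi>"] by force
  have "?o \<xi> \<le> ?o \<zeta>" if \<xi>: "\<xi> \<in> cbox lo hi" for \<xi>
  proof -
    obtain \<eta> where "\<eta> \<in> ?G" "q \<xi> - \<beta> * norm1 (\<xi> - \<xi>e s) \<le> q \<eta> - \<beta> * norm1 (\<eta> - \<xi>e s)"
      using grid_point_improves[OF q e \<xi>] by blast
    then have "?o \<xi> \<le> ?o \<eta>"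
      using \<pi> by (auto simp: pricing_objective_def m intro!: mult_left_mono)
    with \<zeta>(2) \<open>\<eta> \<in> ?G\<close> show ?thesis by force
  qed
  moreover have "\<zeta> \<in> cbox lo hi" using \<zeta>(1) grid_subset_box[OF e] by blast
  ultimately have "pricing_solution lo hi \<xi>e \<pi>e q m s \<zeta>"
    using \<zeta>(1) by (fastforce simp: pricing_solution_def is_arg_max_def grid_def not_less)
  then show ?thesis ..
qed

text \<open>The grid bounds the function from above. Reflection in the centre \<open>c\<close> of the box turns an upper bound into a lower
one, as \<open>2 * q c \<le> q \<xi> + q (2 * c - \<xi>)\<close>.\<close>

lemma convex_on_box_bounded:
  fixes lo hi :: "real^'m"
  assumes q: "convex_on (cbox lo hi) q"
  obtains B where "\<And>\<xi>. \<xi> \<in> cbox lo hi \<Longrightarrow> \<bar>q \<xi>\<bar> \<le> B"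
proof (cases "cbox lo hi = {}")
  case True
  then show ?thesis using that by blast
next
  case False
  then have lo: "lo \<in> cbox lo hi" by (fastforce simp: mem_box_cart intro: order_trans)
  have "bdd_above (q ` grid lo hi lo)"
    using grid_finite_card by (intro bdd_above_finite) auto
  then obtain U where U: "\<And>\<zeta>. \<zeta> \<in> grid lo hi lo \<Longrightarrow> q \<zeta> \<le> U"
    by (auto simp: bdd_above_def)
  have up: "q \<xi> \<le> U" if \<xi>: "\<xi> \<in> cbox lo hi" for \<xi>
  proof -
    obtain \<zeta> where "\<zeta> \<in> grid lo hi lo" "q \<xi> - 0 * norm1 (\<xi> - lo) \<le> q \<zeta> - 0 * norm1 (\<zeta> - lo)"
      by (rule grid_point_improves[OF q lo \<xi>])
    then show ?thesis using U by force
  qed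
  define c where "c = (1/2) *\<^sub>R (lo + hi)"
  have low: "2 * q c - U \<le> q \<xi>" if \<xi>: "\<xi> \<in> cbox lo hi" for \<xi>
  proof -
    have \<xi>': "lo + hi - \<xi> \<in> cbox lo hi" using \<xi> by (simp add: mem_box_cart)
    have "c = (1 - 1/2) *\<^sub>R \<xi> + (1/2) *\<^sub>R (lo + hi - \<xi>)"
      by (simp add: c_def vec_eq_iff algebra_simps)
    then have "q c \<le> (1 - 1/2) * q \<xi> + (1/2) * q (lo + hi - \<xi>)"
      using convex_onD[OF q _ _ \<xi> \<xi>', of "1/2"] by simp
    then show ?thesis using up[OF \<xi>'] by simp
  qed
  show ?thesis
    by (rule that[of "\<bar>U\<bar> + \<bar>2 * q c - U\<bar>"]) (use up low in force)
qed

section \<open>Duality for the worst-case expectation\<close>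

text \<open>Viewing the empirical distribution as the image of a finite probability space on the sample indices
settles its countable additivity, and it takes care of samples that coincide.\<close>

lemma empirical_eq_distr:
  fixes \<xi>e :: "'s::finite \<Rightarrow> 'a"
  assumes sig: "sigma_algebra \<Xi> \<F>" and \<xi>e: "\<And>s. \<xi>e s \<in> \<Xi>"
  shows "empirical \<Xi> \<F> \<xi>e \<pi>e
    = distr (point_measure UNIV (\<lambda>s. ennreal (\<pi>e s))) (sigma \<Xi> \<F>) \<xi>e"
proof -
  interpret sigma_algebra \<Xi> \<F> by fact
  have "distr (point_measure UNIV (\<lambda>s. ennreal (\<pi>e s))) (sigma \<Xi> \<F>) \<xi>e
      = measure_of \<Xi> \<F> (\<lambda>E. emeasure (point_measure UNIV (\<lambda>s. ennreal (\<pi>e s))) (\<xi>e -` E))"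
    using space_closed by (simp add: distr_def sigma_sets_eq space_point_measure)
  also have "\<dots> = empirical \<Xi> \<F> \<xi>e \<pi>e"
    unfolding empirical_def
    by (intro measure_of_eq space_closed)
      (auto simp: emeasure_point_measure_finite indicator_def sum.If_cases vimage_def
        intro!: sum.cong)
  finally show ?thesis ..
qed

text \<open>The recourse function enters through its convexity, which gives the grid and boundedness, and its
measurability; these two hypotheses link the linear program above to the distributions below.\<close>

locale worst_case_expectation =
  fixes lo hi :: "real^'m" and \<F> :: "(real^'m) set set"
    and \<xi>e :: "'s::finite \<Rightarrow> real^'m" and \<pi>e :: "'s \<Rightarrow> real" and r :: real
    and q :: "real^'m \<Rightarrow> real"
  assumes sigma: "sigma_algebra (cbox lo hi) \<F>"
    and borel: "sets (restrict_space borel (cbox lo hi)) \<subseteq> \<F>"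
    and samples: "\<And>s. \<xi>e s \<in> cbox lo hi"
    and weights: "\<And>s. 0 \<le> \<pi>e s" "(\<Sum>s\<in>UNIV. \<pi>e s) = 1"
    and radius: "0 \<le> r"
    and convex: "convex_on (cbox lo hi) q"
    and measurable_q: "q \<in> borel_measurable (restrict_space borel (cbox lo hi))"
begin

abbreviation "\<Xi> \<equiv> cbox lo hi"

abbreviation "E \<equiv> empirical \<Xi> \<F> \<xi>e \<pi>e"

abbreviation "Amb \<equiv> ambiguity_set \<Xi> \<F> \<xi>e \<pi>e r"

lemma space_sets_empirical [simp]: "space E = \<Xi>" "sets E = \<F>"
proof -
  interpret sigma_algebra \<Xi> \<F> by (rule sigma)
  show "space E = \<Xi>" "sets E = \<F>"
    by (simp_all add: empirical_eq_distr[OF sigma samples] space_closed sigma_sets_eq)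
qed

lemma borel_measurable_sample_space:
  assumes "sets P = \<F>" "f \<in> borel_measurable (restrict_space borel \<Xi>)"
  shows "f \<in> borel_measurable P"
proof -
  interpret sigma_algebra \<Xi> \<F> by (rule sigma)
  have "space P = \<Xi>"
    using sets_eq_imp_space_eq[of P E] assms(1) by simp
  then show ?thesis
    using assms borel by (auto simp: measurable_def space_restrict_space)
qed

lemma borel_measurable_sample_space':
  "sets P = \<F> \<Longrightarrow> f \<in> borel_measurable borel \<Longrightarrow> f \<in> borel_measurable P"
  by (rule borel_measurable_sample_space[OF _ measurable_restrict_space1])

lemma integral_empirical:
  fixes f :: "real^'m \<Rightarrow> real"
  assumes "f \<in> borel_measurable E"
  shows "(\<integral>e. f e \<partial>E) = (\<Sum>s\<in>UNIV. \<pi>e s * f (\<xi>e s))"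
proof -
  have "(\<integral>e. f e \<partial>E) = (\<integral>s. f (\<xi>e s) \<partial>point_measure UNIV (\<lambda>s. ennreal (\<pi>e s)))"
    unfolding empirical_eq_distr[OF sigma samples]
    using assms samples space_sets_empirical
    by (intro integral_distr) (auto simp: empirical_eq_distr[OF sigma samples])
  also have "\<dots> = (\<Sum>s\<in>UNIV. \<pi>e s * f (\<xi>e s))"
    using weights by (simp add: lebesgue_integral_point_measure_finite)
  finally show ?thesis .
qed

text \<open>The Kantorovich potential: \<open>q \<xi> \<le> potential \<beta> e + \<beta> * norm1 (\<xi> - e)\<close> holds for \<open>\<beta> \<ge> 0\<close>,
all scenarios \<open>\<xi>\<close> of the box and all \<open>e\<close>, in particular for pairs drawn from a coupling.\<close>

definition potential :: "real \<Rightarrow> real^'m \<Rightarrow> real" where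
  "potential \<beta> e = (SUP \<xi>\<in>\<Xi>. q \<xi> - \<beta> * norm1 (\<xi> - e))"

lemma nonempty: "\<Xi> \<noteq> {}"
  using samples by blast

context
  fixes \<beta> :: real
  assumes \<beta>: "0 \<le> \<beta>"
begin

lemma bdd_above_potential: "bdd_above ((\<lambda>\<xi>. q \<xi> - \<beta> * norm1 (\<xi> - e)) ` \<Xi>)"
proof -
  obtain B where "\<And>\<xi>. \<xi> \<in> \<Xi> \<Longrightarrow> \<bar>q \<xi>\<bar> \<le> B"
    using convex_on_box_bounded[OF convex] by blast
  then have "q \<xi> - \<beta> * norm1 (\<xi> - e) \<le> B" if "\<xi> \<in> \<Xi>" for \<xi>
    using that mult_nonneg_nonneg[OF \<beta> norm1_nonneg[of "\<xi> - e"]] by force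
  then show ?thesis by (auto simp: bdd_above_def)
qed

lemma le_potential: "\<xi> \<in> \<Xi> \<Longrightarrow> q \<xi> \<le> potential \<beta> e + \<beta> * norm1 (\<xi> - e)"
  using cSUP_upper[OF _ bdd_above_potential, of \<xi> e] by (simp add: potential_def)

lemma potential_bounded:
  obtains B where "\<And>e. e \<in> \<Xi> \<Longrightarrow> \<bar>potential \<beta> e\<bar> \<le> B"
proof -
  obtain B where B: "\<And>\<xi>. \<xi> \<in> \<Xi> \<Longrightarrow> \<bar>q \<xi>\<bar> \<le> B"
    using convex_on_box_bounded[OF convex] by blast
  have "potential \<beta> e \<le> B" for e
    unfolding potential_def
  proof (rule cSUP_least[OF nonempty])
    fix \<xi> assume "\<xi> \<in> \<Xi>"
    then show "q \<xi> - \<beta> * norm1 (\<xi> - e) \<le> B"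
      using B[of \<xi>] mult_nonneg_nonneg[OF \<beta> norm1_nonneg[of "\<xi> - e"]] by simp
  qed
  moreover have "- B \<le> potential \<beta> e" if "e \<in> \<Xi>" for e
    using le_potential[OF that, of e] B[OF that] by (simp add: norm1_def)
  ultimately show ?thesis
    by (intro that[of B]) (simp add: abs_le_iff minus_le_iff)
qed

text \<open>As a supremum of continuous functions of \<open>e\<close>, the potential is lower semicontinuous.\<close>

lemma borel_measurable_potential: "potential \<beta> \<in> borel_measurable borel"
proof (rule borel_measurable_iff_greater[THEN iffD2], rule allI)
  fix c
  have "{e. c < potential \<beta> e} = (\<Union>\<xi>\<in>\<Xi>. {e. c < q \<xi> - \<beta> * norm1 (\<xi> - e)})"
    by (auto simp: potential_def less_cSUP_iff[OF nonempty bdd_above_potential])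
  also have "open \<dots>"
    by (intro open_UN ballI open_Collect_less continuous_intros)
  finally show "{e \<in> space borel. c < potential \<beta> e} \<in> sets borel"
    by simp
qed

end

text \<open>Integrate the defining inequality of the potential over the coupling. The first marginal yields the
expectation under \<open>P\<close>, the second one the empirical average of the potential.\<close>

lemma coupling_bound:
  assumes P: "P \<in> distributions \<Xi> \<F>" and \<gamma>: "\<gamma> \<in> couplings P E" and \<beta>: "0 \<le> \<beta>"
    and cost: "(\<integral>\<^sup>+ z. ennreal (norm1 (fst z - snd z)) \<partial>\<gamma>) \<le> ennreal c" and c: "0 \<le> c"
  shows "(\<integral>\<xi>. q \<xi> \<partial>P) \<le> (\<Sum>s\<in>UNIV. \<pi>e s * potential \<beta> (\<xi>e s)) + \<beta> * c"
proof -
  have setsP: "sets P = \<F>" and spaceP: "space P = \<Xi>" and "prob_space P"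
    using P by (auto simp: distributions_def)
  have sets\<gamma>: "sets \<gamma> = sets (P \<Otimes>\<^sub>M E)"
    and P_eq: "distr \<gamma> P fst = P" and E_eq: "distr \<gamma> E snd = E"
    using \<gamma> by (auto simp: couplings_def)
  have space\<gamma>: "space \<gamma> = \<Xi> \<times> \<Xi>"
    using sets_eq_imp_space_eq[OF sets\<gamma>] by (simp add: space_pair_measure spaceP)
  have fstm: "fst \<in> measurable \<gamma> P" and sndm: "snd \<in> measurable \<gamma> E"
    by (simp_all add: measurable_cong_sets[OF sets\<gamma> refl])
  interpret \<gamma>: prob_space \<gamma>
    using prob_space_distrD[OF fstm] P_eq \<open>prob_space P\<close> by simp
  have idP: "(\<lambda>x. x) \<in> borel_measurable P" and idE: "(\<lambda>x. x) \<in> borel_measurable E"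
    by (rule borel_measurable_sample_space'; simp add: setsP)+
  have qP: "q \<in> borel_measurable P"
    by (rule borel_measurable_sample_space[OF setsP measurable_q])
  have LE: "potential \<beta> \<in> borel_measurable E"
    by (rule borel_measurable_sample_space'[OF _ borel_measurable_potential[OF \<beta>]]) simp
  have fst': "fst \<in> borel_measurable \<gamma>" and snd': "snd \<in> borel_measurable \<gamma>"
    using measurable_compose[OF fstm idP] measurable_compose[OF sndm idE] by auto
  have "norm1 \<in> borel_measurable borel"
    by (intro borel_measurable_continuous_onI continuous_intros)
  then have dist_m: "(\<lambda>z. norm1 (fst z - snd z)) \<in> borel_measurable \<gamma>"
    using fst' snd' by (intro measurable_compose[OF borel_measurable_diff])
  have int_dist: "integrable \<gamma> (\<lambda>z. norm1 (fst z - snd z))"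
    using dist_m le_less_trans[OF cost ennreal_less_top]
    by (intro integrableI_nonneg) (auto simp: norm1_nonneg)
  have dist_le: "(\<integral>z. norm1 (fst z - snd z) \<partial>\<gamma>) \<le> c"
    using dist_m cost c by (subst integral_eq_nn_integral) (auto simp: norm1_nonneg enn2real_leI)
  obtain B where B: "\<And>\<xi>. \<xi> \<in> \<Xi> \<Longrightarrow> \<bar>q \<xi>\<bar> \<le> B"
    using convex_on_box_bounded[OF convex] by blast
  obtain L where L: "\<And>e. e \<in> \<Xi> \<Longrightarrow> \<bar>potential \<beta> e\<bar> \<le> L"
    using potential_bounded[OF \<beta>] by blast
  have int_q: "integrable \<gamma> (\<lambda>z. q (fst z))"
    using B space\<gamma> measurable_compose[OF fstm qP]
    by (intro \<gamma>.integrable_const_bound[where B = B]) auto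
  have int_L: "integrable \<gamma> (\<lambda>z. potential \<beta> (snd z))"
    using L space\<gamma> measurable_compose[OF sndm LE]
    by (intro \<gamma>.integrable_const_bound[where B = L]) auto
  have "(\<integral>\<xi>. q \<xi> \<partial>P) = (\<integral>z. q (fst z) \<partial>\<gamma>)"
    using integral_distr[OF fstm qP] P_eq by simp
  also have "\<dots> \<le> (\<integral>z. potential \<beta> (snd z) + \<beta> * norm1 (fst z - snd z) \<partial>\<gamma>)"
    using int_q int_L int_dist space\<gamma>
    by (intro integral_mono) (auto intro: le_potential[OF \<beta>])
  also have "\<dots> = (\<integral>z. potential \<beta> (snd z) \<partial>\<gamma>) + \<beta> * (\<integral>z. norm1 (fst z - snd z) \<partial>\<gamma>)"
    using int_L int_dist by simp
  also have "(\<integral>z. potential \<beta> (snd z) \<partial>\<gamma>) = (\<integral>e. potential \<beta> e \<partial>E)"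
    using integral_distr[OF sndm LE] E_eq by simp
  also have "\<dots> = (\<Sum>s\<in>UNIV. \<pi>e s * potential \<beta> (\<xi>e s))"
    by (rule integral_empirical[OF LE])
  also have "\<beta> * (\<integral>z. norm1 (fst z - snd z) \<partial>\<gamma>) \<le> \<beta> * c"
    using dist_le \<beta> by (rule mult_left_mono)
  finally show ?thesis by simp
qed

text \<open>Dual feasibility for all scenarios says that \<open>\<alpha> s\<close> dominates \<open>\<pi>e s\<close> times the potential at the
sample. The infimum in the Wasserstein distance is approximated by a coupling of cost below \<open>r + \<delta>\<close>.\<close>

lemma ambiguity_weak_duality:
  assumes P: "P \<in> Amb" and m: "dual_feasible \<xi>e \<pi>e q (\<lambda>_. \<Xi>) m"
  shows "(\<integral>\<xi>. q \<xi> \<partial>P) \<le> dual_objective r m"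
proof -
  obtain \<alpha> \<beta> where mm: "m = (\<alpha>, \<beta>)" by fastforce
  have \<beta>: "0 \<le> \<beta>" and \<alpha>: "\<And>s \<xi>. \<xi> \<in> \<Xi> \<Longrightarrow> \<pi>e s * q \<xi> \<le> \<alpha> s + \<pi>e s * norm1 (\<xi> - \<xi>e s) * \<beta>"
    using m by (auto simp: mm dual_feasible_def)
  \<comment> \<open>A sample of probability zero must be treated separately: its \<open>\<alpha> s\<close> is only known to be
    nonnegative.\<close>
  have pot: "\<pi>e s * potential \<beta> (\<xi>e s) \<le> \<alpha> s" for s
  proof (cases "\<pi>e s = 0")
    case True
    then show ?thesis using \<alpha>[OF samples, of s] by simp
  next
    case False
    then have pos: "0 < \<pi>e s" using weights(1)[of s] by simp
    have "potential \<beta> (\<xi>e s) \<le> \<alpha> s / \<pi>e s"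
      unfolding potential_def
    proof (rule cSUP_least[OF nonempty])
      fix \<xi> assume "\<xi> \<in> \<Xi>"
      from \<alpha>[OF this, of s] have "(q \<xi> - \<beta> * norm1 (\<xi> - \<xi>e s)) * \<pi>e s \<le> \<alpha> s"
        by (simp add: algebra_simps)
      then show "q \<xi> - \<beta> * norm1 (\<xi> - \<xi>e s) \<le> \<alpha> s / \<pi>e s"
        using pos by (simp add: pos_le_divide_eq)
    qed
    then show ?thesis using pos by (simp add: pos_le_divide_eq mult.commute)
  qed
  have "(\<integral>\<xi>. q \<xi> \<partial>P) \<le> dual_objective r m + \<epsilon>" if "0 < \<epsilon>" for \<epsilon>
  proof -
    define \<delta> where "\<delta> = \<epsilon> / (\<beta> + 1)"
    have \<delta>: "0 < \<delta>" "\<beta> * \<delta> \<le> \<epsilon>"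
      using \<beta> that by (auto simp: \<delta>_def field_simps)
    have "wasserstein P E \<le> ennreal r"
      using P by (simp add: ambiguity_set_def)
    also have "\<dots> < ennreal (r + \<delta>)"
      using \<delta> radius by (simp add: ennreal_less_iff)
    finally have "wasserstein P E < ennreal (r + \<delta>)" .
    then obtain \<gamma> where \<gamma>: "\<gamma> \<in> couplings P E"
      "(\<integral>\<^sup>+ z. ennreal (norm1 (fst z - snd z)) \<partial>\<gamma>) < ennreal (r + \<delta>)"
      unfolding wasserstein_def INF_less_iff by blast
    have "(\<integral>\<xi>. q \<xi> \<partial>P) \<le> (\<Sum>s\<in>UNIV. \<pi>e s * potential \<beta> (\<xi>e s)) + \<beta> * (r + \<delta>)"
      using P \<gamma> \<beta> \<delta> radius by (intro coupling_bound) (auto simp: ambiguity_set_def)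
    also have "\<dots> \<le> (\<Sum>s\<in>UNIV. \<alpha> s) + \<beta> * (r + \<delta>)"
      by (intro add_right_mono sum_mono pot)
    also have "\<dots> \<le> dual_objective r m + \<epsilon>"
      using \<delta> by (simp add: mm dual_objective_def algebra_simps)
    finally show ?thesis .
  qed
  then show ?thesis by (rule field_le_epsilon)
qed

text \<open>Draw a sample index \<open>s\<close> with probability \<open>\<pi>e s\<close>, and then a scenario \<open>\<xi>\<close> with probability \<open>p s \<xi>\<close>.
The law \<open>P\<close> of the scenario is the required distribution, and the joint law \<open>\<gamma>\<close> of the scenario and the
sample point is a coupling whose transport cost is the left-hand side of the budget constraint.\<close>

lemma master_solution_distribution:
  assumes p: "master_feasible \<xi>e \<pi>e r \<Omega> p" and fin: "\<And>s. finite (\<Omega> s)" and sub: "\<And>s. \<Omega> s \<subseteq> \<Xi>"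
  obtains P where "P \<in> Amb" "(\<integral>\<xi>. q \<xi> \<partial>P) = master_objective \<pi>e q \<Omega> p"
proof -
  define A where "A = Sigma UNIV \<Omega>"
  define w where "w = (\<lambda>(s, \<xi>). \<pi>e s * p s \<xi>)"
  define M where "M = point_measure A (\<lambda>a. ennreal (w a))"
  define P where "P = distr M E snd"
  define \<gamma> where "\<gamma> = distr M (P \<Otimes>\<^sub>M E) (\<lambda>a. (snd a, \<xi>e (fst a)))"
  have finA: "finite A" using fin by (simp add: A_def)
  have w0: "0 \<le> w a" if "a \<in> A" for a
    using that p weights by (auto simp: A_def w_def master_feasible_def)
  have sum_A: "(\<Sum>a\<in>A. f a) = (\<Sum>s\<in>UNIV. \<Sum>\<xi>\<in>\<Omega> s. f (s, \<xi>))" for f :: "'s \<times> (real^'m) \<Rightarrow> real"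
    unfolding A_def using fin by (subst sum.Sigma) (auto simp: case_prod_beta)
  have spM: "space M = A" by (simp add: M_def space_point_measure)
  have sndM: "snd \<in> measurable M E"
    using subsetD[OF sub] by (auto simp: M_def A_def)
  have fstM: "(\<lambda>a. \<xi>e (fst a)) \<in> measurable M E"
    using samples by (auto simp: M_def)
  have setsP: "sets P = \<F>" and spaceP: "space P = \<Xi>"
    by (simp_all add: P_def)
  have pairM: "(\<lambda>a. (snd a, \<xi>e (fst a))) \<in> measurable M (P \<Otimes>\<^sub>M E)"
    using sndM fstM by (intro measurable_Pair) (auto simp: P_def)
  define W where "W = point_measure UNIV (\<lambda>s. ennreal (\<pi>e s))"
  have marginal: "distr M W fst = W"
  proof (rule measure_eqI)
    fix X
    have "emeasure (distr M W fst) X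
        = emeasure M (fst -` X \<inter> A)"
      by (subst emeasure_distr) (auto simp: M_def W_def space_point_measure sets_point_measure)
    also have "\<dots> = (\<Sum>a\<in>fst -` X \<inter> A. ennreal (w a))"
      using finA by (simp add: M_def emeasure_point_measure_finite)
    also have "\<dots> = ennreal (\<Sum>a\<in>Sigma X \<Omega>. w a)"
      using w0 by (subst sum_ennreal) (auto simp: A_def intro!: sum.cong arg_cong[where f = ennreal])
    also have "(\<Sum>a\<in>Sigma X \<Omega>. w a) = (\<Sum>s\<in>X. \<Sum>\<xi>\<in>\<Omega> s. \<pi>e s * p s \<xi>)"
      using fin by (subst sum.Sigma) (auto simp: w_def)
    also have "\<dots> = (\<Sum>s\<in>X. \<pi>e s)"
      using p by (simp add: sum_distrib_left[symmetric] master_feasible_def)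
    also have "ennreal \<dots> = emeasure W X"
      using weights by (simp add: W_def emeasure_point_measure_finite sum_ennreal)
    finally show "emeasure (distr M W fst) X
        = emeasure W X" .
  qed (simp add: W_def)
  have "distr M E (\<lambda>a. \<xi>e (fst a))
      = distr (distr M W fst) E \<xi>e"
    using samples by (subst distr_distr) (auto simp: comp_def M_def W_def space_point_measure)
  also have "\<dots> = distr W (sigma \<Xi> \<F>) \<xi>e"
    unfolding marginal
    by (rule distr_cong) (simp_all only: empirical_eq_distr[OF sigma samples] sets_distr)
  also have "\<dots> = E"
    by (simp only: empirical_eq_distr[OF sigma samples] W_def)
  finally have E_eq: "distr M E (\<lambda>a. \<xi>e (fst a)) = E" .
  have "emeasure M A = 1"
  proof -
    have "emeasure M A = ennreal (\<Sum>a\<in>A. w a)"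
      using finA w0 by (simp add: M_def emeasure_point_measure_finite sum_ennreal)
    also have "(\<Sum>a\<in>A. w a) = 1"
      using p weights by (simp add: sum_A w_def sum_distrib_left[symmetric] master_feasible_def)
    finally show ?thesis by simp
  qed
  then interpret M: prob_space M
    by (intro prob_spaceI) (simp add: spM)
  have "prob_space P"
    unfolding P_def by (rule M.prob_space_distr[OF sndM])
  then have dist: "P \<in> distributions \<Xi> \<F>"
    by (simp add: distributions_def setsP spaceP)
  have "distr \<gamma> P fst = P"
    unfolding \<gamma>_def by (subst distr_distr[OF _ pairM]) (auto simp: comp_def P_def intro: distr_cong)
  moreover have "distr \<gamma> E snd = E"
    unfolding \<gamma>_def by (subst distr_distr[OF _ pairM]) (auto simp: comp_def E_eq)
  ultimately have \<gamma>: "\<gamma> \<in> couplings P E"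
    by (simp add: couplings_def \<gamma>_def)
  have nm: "norm1 \<in> borel_measurable borel"
    by (intro borel_measurable_continuous_onI continuous_intros)
  have idP: "(\<lambda>x. x) \<in> borel_measurable P" and idE: "(\<lambda>x. x) \<in> borel_measurable E"
    by (rule borel_measurable_sample_space'; simp add: setsP)+
  have dm: "(\<lambda>z. norm1 (fst z - snd z)) \<in> borel_measurable (P \<Otimes>\<^sub>M E)"
    by (intro measurable_compose[OF borel_measurable_diff nm] measurable_compose[OF measurable_fst idP]
        measurable_compose[OF measurable_snd idE])
  have "wasserstein P E \<le> (\<integral>\<^sup>+ z. ennreal (norm1 (fst z - snd z)) \<partial>\<gamma>)"
    unfolding wasserstein_def by (rule INF_lower[OF \<gamma>])
  also have "\<dots> = (\<integral>\<^sup>+ a. ennreal (norm1 (snd a - \<xi>e (fst a))) \<partial>M)"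
    unfolding \<gamma>_def using dm by (subst nn_integral_distr[OF pairM]) auto
  also have "\<dots> = (\<Sum>a\<in>A. ennreal (w a * norm1 (snd a - \<xi>e (fst a))))"
    unfolding M_def using finA w0
    by (simp add: nn_integral_point_measure_finite ennreal_mult norm1_nonneg)
  also have "\<dots> = ennreal (\<Sum>a\<in>A. w a * norm1 (snd a - \<xi>e (fst a)))"
    using w0 by (intro sum_ennreal) (auto simp: norm1_nonneg)
  also have "(\<Sum>a\<in>A. w a * norm1 (snd a - \<xi>e (fst a)))
      = (\<Sum>s\<in>UNIV. \<pi>e s * (\<Sum>\<xi>\<in>\<Omega> s. norm1 (\<xi> - \<xi>e s) * p s \<xi>))"
    by (simp add: sum_A w_def sum_distrib_left mult_ac)
  also have "ennreal \<dots> \<le> ennreal r"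
    using p by (intro ennreal_leI) (simp add: master_feasible_def)
  finally have "P \<in> Amb"
    using dist by (simp add: ambiguity_set_def)
  moreover have "(\<integral>\<xi>. q \<xi> \<partial>P) = master_objective \<pi>e q \<Omega> p"
  proof -
    have "q \<in> borel_measurable E"
      by (rule borel_measurable_sample_space[OF _ measurable_q]) simp
    then have "(\<integral>\<xi>. q \<xi> \<partial>P) = (\<integral>a. q (snd a) \<partial>M)"
      unfolding P_def by (intro integral_distr sndM)
    also have "\<dots> = (\<Sum>a\<in>A. w a * q (snd a))"
      unfolding M_def using finA w0 by (simp add: lebesgue_integral_point_measure_finite)
    also have "\<dots> = master_objective \<pi>e q \<Omega> p"
      by (simp add: sum_A w_def master_objective_def mult_ac)
    finally show ?thesis .
  qed
  ultimately show ?thesis by (rule that)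
qed

text \<open>The bound of \<open>ambiguity_weak_duality\<close> is met by the distribution of an optimal master solution. An
infeasible master problem is impossible here: constraints at the sample points force the dual value
to be at least the empirical expectation, whereas the multipliers chosen for an infeasible master
problem lie below it.\<close>

lemma stationary_dual_solves:
  assumes fin: "\<And>s. finite (\<Omega> s)" and sub: "\<And>s. \<Omega> s \<subseteq> \<Xi>"
    and m: "master_multipliers \<xi>e \<pi>e r q \<Omega> m" and dual: "dual_feasible \<xi>e \<pi>e q (\<lambda>_. \<Xi>) m"
  obtains p P where
    "is_arg_max (master_objective \<pi>e q \<Omega>) (master_feasible \<xi>e \<pi>e r \<Omega>) p"
    "is_arg_max (\<lambda>P. \<integral>\<xi>. q \<xi> \<partial>P) (\<lambda>P. P \<in> Amb) P"
    "master_objective \<pi>e q \<Omega> p = (\<integral>\<xi>. q \<xi> \<partial>P)"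
proof -
  obtain \<alpha> \<beta> where mm: "m = (\<alpha>, \<beta>)" by fastforce
  have "(\<Sum>s\<in>UNIV. \<pi>e s * q (\<xi>e s)) \<le> (\<Sum>s\<in>UNIV. \<alpha> s)"
  proof (rule sum_mono)
    fix s
    have "\<pi>e s * q (\<xi>e s) \<le> \<alpha> s + \<pi>e s * norm1 (\<xi>e s - \<xi>e s) * \<beta>"
      using dual samples unfolding mm dual_feasible_def by blast
    then show "\<pi>e s * q (\<xi>e s) \<le> \<alpha> s" by (simp add: norm1_def)
  qed
  also have "\<dots> \<le> dual_objective r m"
    using dual radius by (simp add: mm dual_objective_def dual_feasible_def)
  finally obtain p0 where p0: "master_feasible \<xi>e \<pi>e r \<Omega> p0"
    using m by (auto simp: master_multipliers_def split: if_splits)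
  then have "is_arg_min (dual_objective r) (dual_feasible \<xi>e \<pi>e q \<Omega>) m"
    using m by (auto simp: master_multipliers_def split: if_splits)
  then obtain p where p: "is_arg_max (master_objective \<pi>e q \<Omega>) (master_feasible \<xi>e \<pi>e r \<Omega>) p"
    "master_objective \<pi>e q \<Omega> p = dual_objective r m"
    by (rule master_optimal_value[OF fin p0])
  have "master_feasible \<xi>e \<pi>e r \<Omega> p"
    using p(1) by (simp add: is_arg_max_def)
  then obtain P where P: "P \<in> Amb" "(\<integral>\<xi>. q \<xi> \<partial>P) = master_objective \<pi>e q \<Omega> p"
    using fin sub by (rule master_solution_distribution)
  then have "is_arg_max (\<lambda>P. \<integral>\<xi>. q \<xi> \<partial>P) (\<lambda>P. P \<in> Amb) P"
    using ambiguity_weak_duality[OF _ dual] p(2) by (simp add: is_arg_max_linorder)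
  with p(1) P(2) show ?thesis by (intro that) auto
qed

text \<open>Since grid points maximise the price, the dual constraints at grid points imply all others.\<close>

lemma dual_feasible_grid:
  assumes "dual_feasible \<xi>e \<pi>e q (\<lambda>s. grid lo hi (\<xi>e s)) m"
  shows "dual_feasible \<xi>e \<pi>e q (\<lambda>_. \<Xi>) m"
proof -
  obtain \<alpha> \<beta> where mm: "m = (\<alpha>, \<beta>)" by fastforce
  have "\<pi>e s * q \<xi> \<le> \<alpha> s + \<pi>e s * norm1 (\<xi> - \<xi>e s) * \<beta>" if \<xi>: "\<xi> \<in> \<Xi>" for s \<xi>
  proof -
    obtain \<zeta> where \<zeta>: "\<zeta> \<in> grid lo hi (\<xi>e s)"
      "q \<xi> - \<beta> * norm1 (\<xi> - \<xi>e s) \<le> q \<zeta> - \<beta> * norm1 (\<zeta> - \<xi>e s)"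
      using grid_point_improves[OF convex samples \<xi>] by blast
    have "\<pi>e s * q \<zeta> \<le> \<alpha> s + \<pi>e s * norm1 (\<zeta> - \<xi>e s) * \<beta>"
      using assms \<zeta>(1) by (simp add: mm dual_feasible_def)
    with mult_left_mono[OF \<zeta>(2) weights(1)[of s]] show ?thesis
      by (simp add: algebra_simps)
  qed
  then show ?thesis
    using assms by (simp add: mm dual_feasible_def)
qed

text \<open>The whole grid plays the role of the available scenarios.\<close>

lemma worst_case_distribution_exists:
  obtains P where "is_arg_max (\<lambda>P. \<integral>\<xi>. q \<xi> \<partial>P) (\<lambda>P. P \<in> Amb) P"
proof -
  let ?G = "\<lambda>s. grid lo hi (\<xi>e s)"
  obtain m where m: "master_multipliers \<xi>e \<pi>e r q ?G m"
    using master_multipliers_exist[of ?G] grid_finite_card by blast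
  then have "dual_feasible \<xi>e \<pi>e q ?G m"
    by (auto simp: master_multipliers_def is_arg_min_def split: if_splits)
  then have "dual_feasible \<xi>e \<pi>e q (\<lambda>_. \<Xi>) m"
    by (rule dual_feasible_grid)
  then show ?thesis
    using stationary_dual_solves[of ?G m] grid_finite_card grid_subset_box[OF samples] m that
    by metis
qed

section \<open>Column generation\<close>

lemma stopping_solves:
  assumes fin: "\<And>s. finite (\<Omega> s)" and sub: "\<And>s. \<Omega> s \<subseteq> \<Xi>"
    and stop: "cg_stops lo hi \<xi>e \<pi>e r q \<Omega>"
  obtains p P where
    "is_arg_max (master_objective \<pi>e q \<Omega>) (master_feasible \<xi>e \<pi>e r \<Omega>) p"
    "is_arg_max (\<lambda>P. \<integral>\<xi>. q \<xi> \<partial>P) (\<lambda>P. P \<in> Amb) P"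
    "master_objective \<pi>e q \<Omega> p = (\<integral>\<xi>. q \<xi> \<partial>P)"
proof -
  obtain m \<zeta> where m: "master_multipliers \<xi>e \<pi>e r q \<Omega> m"
    and sol: "\<And>s. pricing_solution lo hi \<xi>e \<pi>e q m s (\<zeta> s)"
    and nonpos: "\<And>s. pricing_objective \<xi>e \<pi>e q m s (\<zeta> s) \<le> 0"
    using stop by (auto simp: cg_stops_def cg_pass_def simp del: split_paired_Ex)
  obtain \<alpha> \<beta> where mm: "m = (\<alpha>, \<beta>)" by fastforce
  have "pricing_objective \<xi>e \<pi>e q m s \<xi> \<le> 0" if "\<xi> \<in> \<Xi>" for s \<xi>
    using sol[of s] nonpos[of s] that
    by (auto simp: pricing_solution_def is_arg_max_linorder intro: order_trans)
  moreover have "0 \<le> \<beta>"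
    using m by (auto simp: mm master_multipliers_def is_arg_min_def dual_feasible_def split: if_splits)
  ultimately have "dual_feasible \<xi>e \<pi>e q (\<lambda>_. \<Xi>) m"
    by (simp add: mm dual_feasible_def pricing_objective_nonpos_iff)
  then show ?thesis
    using stationary_dual_solves[OF fin sub m] that by metis
qed

text \<open>Dual feasibility keeps the price of available scenarios nonpositive, so a scenario with positive
price is new.\<close>

lemma cg_step_adds_grid_point:
  assumes step: "cg_step lo hi \<xi>e \<pi>e r q \<Omega> \<Omega>'" and fin: "\<And>s. finite (\<Omega> s)"
    and sub: "\<And>s. \<Omega> s \<subseteq> \<Xi>"
  shows "finite (\<Omega>' s)" "\<Omega>' s \<subseteq> \<Xi>"
    "(\<Sum>s\<in>UNIV. card (\<Omega> s \<inter> grid lo hi (\<xi>e s))) < (\<Sum>s\<in>UNIV. card (\<Omega>' s \<inter> grid lo hi (\<xi>e s)))"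
proof -
  let ?G = "\<lambda>s. grid lo hi (\<xi>e s)"
  obtain m \<zeta> T where m: "master_multipliers \<xi>e \<pi>e r q \<Omega> m"
    and sol: "\<And>s. pricing_solution lo hi \<xi>e \<pi>e q m s (\<zeta> s)"
    and T: "T \<noteq> {}" "\<And>s. s \<in> T \<Longrightarrow> 0 < pricing_objective \<xi>e \<pi>e q m s (\<zeta> s)"
    and \<Omega>': "\<Omega>' = (\<lambda>s. if s \<in> T then \<Omega> s \<union> {\<zeta> s} else \<Omega> s)"
    using step unfolding cg_step_def cg_pass_def by blast
  obtain \<alpha> \<beta> where mm: "m = (\<alpha>, \<beta>)" by fastforce
  have \<zeta>: "\<zeta> s \<in> \<Xi>" "\<zeta> s \<in> ?G s" for s
    using sol[of s] by (auto simp: pricing_solution_def is_arg_max_def grid_def)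
  have fin': "finite (\<Omega>' s)" for s
    using fin by (simp add: \<Omega>')
  then show "finite (\<Omega>' s)" .
  show "\<Omega>' s \<subseteq> \<Xi>"
    using sub \<zeta> by (simp add: \<Omega>')
  have "dual_feasible \<xi>e \<pi>e q \<Omega> m"
    using m by (auto simp: master_multipliers_def is_arg_min_def split: if_splits)
  then have "pricing_objective \<xi>e \<pi>e q m s \<xi> \<le> 0" if "\<xi> \<in> \<Omega> s" for s \<xi>
    using that by (simp add: mm pricing_objective_nonpos_iff dual_feasible_def)
  with T(2) have new: "\<zeta> s \<notin> \<Omega> s" if "s \<in> T" for s
    using that by force
  obtain t where t: "t \<in> T" using T(1) by blast
  have "\<Omega> t \<inter> ?G t \<subset> \<Omega>' t \<inter> ?G t"
    using new[OF t] t \<zeta> by (auto simp: \<Omega>')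
  then have "card (\<Omega> t \<inter> ?G t) < card (\<Omega>' t \<inter> ?G t)"
    using fin' by (intro psubset_card_mono) auto
  moreover have "card (\<Omega> s \<inter> ?G s) \<le> card (\<Omega>' s \<inter> ?G s)" for s
    using fin' by (intro card_mono) (auto simp: \<Omega>')
  ultimately show "(\<Sum>s\<in>UNIV. card (\<Omega> s \<inter> ?G s)) < (\<Sum>s\<in>UNIV. card (\<Omega>' s \<inter> ?G s))"
    by (intro sum_strict_mono_ex1) auto
qed

text \<open>Each step adds at least one grid point, and all samples together have at most
\<open>3 ^ CARD('m) * CARD('s)\<close> of them.\<close>

lemma cg_iterates:
  assumes start: "\<And>s. finite (\<Omega>0 s)" "\<And>s. \<Omega>0 s \<subseteq> \<Xi>"
    and run: "(cg_step lo hi \<xi>e \<pi>e r q ^^ k) \<Omega>0 \<Omega>"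
  shows "finite (\<Omega> s)" "\<Omega> s \<subseteq> \<Xi>" "k \<le> 3 ^ CARD('m) * CARD('s)"
proof -
  let ?G = "\<lambda>s. grid lo hi (\<xi>e s)"
  have inv: "(\<forall>s. finite (\<Omega> s) \<and> \<Omega> s \<subseteq> \<Xi>) \<and> k \<le> (\<Sum>s\<in>UNIV. card (\<Omega> s \<inter> ?G s))"
    using run
  proof (induction k arbitrary: \<Omega>)
    case 0
    then show ?case using start by auto
  next
    case (Suc k)
    then obtain \<Omega>1 where \<Omega>1: "(cg_step lo hi \<xi>e \<pi>e r q ^^ k) \<Omega>0 \<Omega>1"
      "cg_step lo hi \<xi>e \<pi>e r q \<Omega>1 \<Omega>" by auto
    with Suc.IH have IH: "\<And>s. finite (\<Omega>1 s)" "\<And>s. \<Omega>1 s \<subseteq> \<Xi>"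
      "k \<le> (\<Sum>s\<in>UNIV. card (\<Omega>1 s \<inter> ?G s))" by blast+
    note adds = cg_step_adds_grid_point[OF \<Omega>1(2) IH(1,2)]
    have "Suc k \<le> (\<Sum>s\<in>UNIV. card (\<Omega> s \<inter> ?G s))"
      using IH(3) adds(3) by linarith
    then show ?case
      using adds(1,2) by simp
  qed
  then show "finite (\<Omega> s)" "\<Omega> s \<subseteq> \<Xi>" by auto
  have "card (\<Omega> s \<inter> ?G s) \<le> 3 ^ CARD('m)" for s
    by (rule order_trans[OF card_mono[OF grid_finite_card(1) Int_lower2] grid_finite_card(2)])
  then have "(\<Sum>s\<in>UNIV. card (\<Omega> s \<inter> ?G s)) \<le> (\<Sum>s\<in>(UNIV :: 's set). 3 ^ CARD('m))"
    by (intro sum_mono)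
  then show "k \<le> 3 ^ CARD('m) * CARD('s)"
    using inv by (simp add: mult.commute)
qed

end

text \<open>The worst-case distribution is fixed before the run is considered. A run that stops
produces a maximiser of its own, and two maximisers have the same expectation.\<close>

theorem corollary2:
  fixes A :: "real^'n^'c" and b :: "real^'c" and Bin :: "'n set"
    and d :: "real^'y" and F :: "real^'y^'l" and h :: "real^'l"
    and G :: "real^'n^'l" and K :: "real^'m^'l"
    and lo hi :: "real^'m" and \<Xi> :: "(real^'m) set" and \<F> :: "(real^'m) set set"
    and \<xi>e :: "'s::finite \<Rightarrow> real^'m" and \<pi>e :: "'s \<Rightarrow> real" and r :: real
    and xhat :: "real^'n" and q :: "real^'m \<Rightarrow> real"
    and \<Omega>0 :: "'s \<Rightarrow> (real^'m) set"
  assumes box: "\<Xi> = cbox lo hi"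
    and sigma: "sigma_algebra \<Xi> \<F>" "sets (restrict_space borel \<Xi>) \<subseteq> \<F>"
    and recourse: "relatively_complete_recourse d F h G K (first_stage_set A b Bin) \<Xi>"
    and samples: "\<And>s. \<xi>e s \<in> \<Xi>" "\<And>s. 0 \<le> \<pi>e s" "(\<Sum>s\<in>UNIV. \<pi>e s) = 1"
    and radius: "0 \<le> r"
    and xhat: "xhat \<in> first_stage_set A b Bin"
    and q: "q = recourse d F h G K xhat"
    and start: "\<And>s. finite (\<Omega>0 s)" "\<And>s. \<Omega>0 s \<subseteq> \<Xi>"
  shows "\<exists>Pmax.
      is_arg_max (\<lambda>P. \<integral>\<xi>. q \<xi> \<partial>P) (\<lambda>P. P \<in> ambiguity_set \<Xi> \<F> \<xi>e \<pi>e r) Pmax \<and>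
      (\<forall>k \<Omega>. (cg_step lo hi \<xi>e \<pi>e r q ^^ k) \<Omega>0 \<Omega> \<longrightarrow>
         k \<le> 3 ^ CARD('m) * CARD('s) \<and>
         (\<exists>m. master_multipliers \<xi>e \<pi>e r q \<Omega> m) \<and>
         (\<forall>m. master_multipliers \<xi>e \<pi>e r q \<Omega> m \<longrightarrow>
            (\<forall>s. \<exists>\<zeta>. pricing_solution lo hi \<xi>e \<pi>e q m s \<zeta>)) \<and>
         (cg_stops lo hi \<xi>e \<pi>e r q \<Omega> \<longrightarrow>
            (\<exists>p. is_arg_max (master_objective \<pi>e q \<Omega>) (master_feasible \<xi>e \<pi>e r \<Omega>) p \<and>
                 master_objective \<pi>e q \<Omega> p = (\<integral>\<xi>. q \<xi> \<partial>Pmax))))"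
proof -
  interpret worst_case_expectation lo hi \<F> \<xi>e \<pi>e r q
  proof (rule worst_case_expectation.intro)
    show "convex_on (cbox lo hi) q"
      using recourse xhat unfolding q box by (rule convex_on_recourse) (rule convex_box)
    show "q \<in> borel_measurable (restrict_space borel (cbox lo hi))"
      using recourse xhat unfolding q box by (rule borel_measurable_recourse) (rule compact_cbox)
  qed (use sigma samples radius in \<open>simp_all add: box\<close>)
  obtain Pmax where Pmax:
    "is_arg_max (\<lambda>P. \<integral>\<xi>. q \<xi> \<partial>P) (\<lambda>P. P \<in> ambiguity_set \<Xi> \<F> \<xi>e \<pi>e r) Pmax"
    unfolding box by (rule worst_case_distribution_exists)
  show ?thesis
  proof (intro exI[of _ Pmax] conjI allI impI Pmax)
    fix k \<Omega> assume run: "(cg_step lo hi \<xi>e \<pi>e r q ^^ k) \<Omega>0 \<Omega>"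
    note it = cg_iterates[OF start[unfolded box] run]
    show "k \<le> 3 ^ CARD('m) * CARD('s)"
      by (rule it(3))
    show "\<exists>m. master_multipliers \<xi>e \<pi>e r q \<Omega> m"
      by (rule master_multipliers_exist[OF it(1)])
    show "\<exists>\<zeta>. pricing_solution lo hi \<xi>e \<pi>e q m s \<zeta>" for m s
      by (rule pricing_solution_exists[OF convex samples weights(1)])
    assume "cg_stops lo hi \<xi>e \<pi>e r q \<Omega>"
    then obtain p P where
      p: "is_arg_max (master_objective \<pi>e q \<Omega>) (master_feasible \<xi>e \<pi>e r \<Omega>) p"
      and P: "is_arg_max (\<lambda>P. \<integral>\<xi>. q \<xi> \<partial>P) (\<lambda>P. P \<in> ambiguity_set \<Xi> \<F> \<xi>e \<pi>e r) P"
      and val: "master_objective \<pi>e q \<Omega> p = (\<integral>\<xi>. q \<xi> \<partial>P)"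
      unfolding box by (rule stopping_solves[OF it(1,2)])
    have "(\<integral>\<xi>. q \<xi> \<partial>P) = (\<integral>\<xi>. q \<xi> \<partial>Pmax)"
      using P Pmax unfolding is_arg_max_linorder by (meson order_antisym)
    with p val show "\<exists>p. is_arg_max (master_objective \<pi>e q \<Omega>) (master_feasible \<xi>e \<pi>e r \<Omega>) p \<and>
        master_objective \<pi>e q \<Omega> p = (\<integral>\<xi>. q \<xi> \<partial>Pmax)"
      by auto
  qed
qed

end
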